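(* Let $X$ be a locally compact Hausdorff space, let $E$ be a KB-space, and let $\pi:\mathrm{C}_0(X)\to E$ be a positive operator. Then there exists a unique regular Borel measure $\mu:\mathscr{B}\to\overline{E^+}$ on the Borel $\sigma$-algebra $\mathscr{B}$ of $X$ such that \[ \pi(f)=\int_X^{\mathrm{o}} f\,\mathrm{d}\mu \] for all $f\in\mathrm{C}_{\mathrm c}(X)$. The measure $\mu$ is finite, and the equation $\pi(f)=\int_X^{\mathrm{o}} f\,\mathrm{d}\mu$ also holds for all $f\in\mathrm{C}_0(X)$. If $V$ is a non-empty open subset of $X$, then \[ \mu(V)=\bigvee\{\pi(f): f\prec V\} \] in $E$. If $K$ is a compact subset of $X$, then \[ \mu(K)=\bigwedge\{\pi(f): K\prec f\} \] in $E$.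
   Context: A KB-space is a (real) Banach lattice in which every increasing norm bounded net in the positive cone is norm convergent; such a space is Dedekind complete, so that the notions below make sense. An operator (always linear) is positive if it maps positive elements to positive elements. Extended space. $\overline{E}=E\cup\{\infty\}$ (disjoint union), ordered by the order of $E$ and $x\le\infty$ for all $x\in\overline E$; $\overline{E^+}=E^+\cup\{\infty\}$; $\infty+x=x+\infty=\infty$; $r\cdot\infty=\infty$ for real $r>0$, $0\cdot\infty=0$. Elements of $E$ are called finite. Measures. A positive $\overline E$-valued measure on $\mathscr{B}$ is a map $\mu:\mathscr{B}\to\overline{E^+}$ with $\mu(\emptyset)=0$ and $\mu(\bigcup_n\Delta_n)=\bigvee_{N=1}^\infty\sum_{n=1}^N\mu(\Delta_n)$ in $\overline E$ for pairwise disjoint sequences $(\Delta_n)$ in $\mathscr{B}$. It is finite if $\mu(X)\in E^+$. Order integral. For a measurable $\varphi=\sum_{i=1}^n r_i\chi_{\Delta_i}\ge 0$ taking finitely many finite values ($r_i\in\mathbb{R}^+$, $\Delta_i\in\mathscr{B}$), $\int_X^{\mathrm o}\varphi\,\mathrm d\mu=\sum_i r_i\mu(\Delta_i)\in\overline{E^+}$. For measurable $f:X\to[0,\infty]$, $\int_X^{\mathrm o}f\,\mathrm d\mu=\bigvee_n\int_X^{\mathrm o}\varphi_n\,\mathrm d\mu$ in $\overline{E}$, for any sequence of such elementary functions $\varphi_n\uparrow f$ pointwise (independent of the choice). A measurable $f:X\to\mathbb{R}$ is integrable if $\int_X^{\mathrm o}|f|\,\mathrm d\mu$ is finite, and then $\int_X^{\mathrm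 o}f\,\mathrm d\mu=\int_X^{\mathrm o}f^+\,\mathrm d\mu-\int_X^{\mathrm o}f^-\,\mathrm d\mu$. Regularity. $\mu$ is a Borel measure if $\mu(K)\in E$ for all compact $K\subseteq X$; it is inner regular at $\Delta$ if $\mu(\Delta)=\bigvee\{\mu(K):K\text{ compact},K\subseteq\Delta\}$ in $\overline E$; outer regular at $\Delta$ if $\mu(\Delta)=\bigwedge\{\mu(V):V\text{ open},\Delta\subseteq V\}$ in $\overline E$. It is a regular Borel measure if it is a Borel measure that is inner regular at all open sets and outer regular at all Borel sets. Functions. $\mathrm{C}_{\mathrm c}(X)$ (resp. $\mathrm{C}_0(X)$) is the space of real-valued continuous functions on $X$ with compact support (resp. vanishing at infinity), with the pointwise order. For $S\subseteq X$, $f\prec S$ means $f\in\mathrm{C}_{\mathrm c}(X)$, $0\le f\le 1$ and $\operatorname{supp}f\subseteq S$; $S\prec f$ means $f\in\mathrm{C}_{\mathrm c}(X)$, $0\le f\le 1$ and $f=1$ on $S$. *)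

theory Defs
  imports
    "HOL-Analysis.Analysis"
    "HOL-Library.Lattice_Algebras"
    "HOL-Library.Lattice_Constructions"
    "HOL-Library.Lub_Glb"
begin

subsection \<open>Banach lattices and KB-spaces\<close>

class banach_lattice = banach + ordered_real_vector + lattice_ab_group_add_abs +
  assumes norm_mono_abs: "\<bar>x\<bar> \<le> \<bar>y\<bar> \<Longrightarrow> norm x \<le> norm y"

definition directed_index :: "'i set \<Rightarrow> ('i \<Rightarrow> 'i \<Rightarrow> bool) \<Rightarrow> bool" where
  "directed_index I r \<longleftrightarrow>
     I \<noteq> {} \<and> (\<forall>i\<in>I. r i i) \<and> (\<forall>i\<in>I. \<forall>j\<in>I. \<forall>k\<in>I. r i j \<longrightarrow> r j k \<longrightarrow> r i k) \<and>
     (\<forall>i\<in>I. \<forall>j\<in>I. \<exists>k\<in>I. r i k \<and> r j k)"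

text \<open>
  A class axiom cannot quantify over index types, so it speaks about nets that are indexed by
  subsets of the space itself. By \<open>kb_net_convergent\<close> below this implies the
  convergence of increasing norm bounded positive nets over index sets of any type.
\<close>

class kb_space = banach_lattice +
  assumes kb_self_indexed:
    "directed_index I r \<Longrightarrow> (\<And>i j. i \<in> (I :: 'a set) \<Longrightarrow> j \<in> I \<Longrightarrow> r i j \<Longrightarrow> x i \<le> x j) \<Longrightarrow>
     (\<And>i. i \<in> I \<Longrightarrow> 0 \<le> x i) \<Longrightarrow> (\<exists>B. \<forall>i\<in>I. norm (x i) \<le> B) \<Longrightarrow>
     \<exists>l. \<forall>\<epsilon>>0. \<exists>i\<in>I. \<forall>j\<in>I. r i j \<longrightarrow> norm ((x :: 'a \<Rightarrow> 'a) j - l) < \<epsilon>"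

lemma kb_net_convergent:
  fixes x :: "'i \<Rightarrow> 'e::kb_space"
  assumes dir: "directed_index I r"
    and mono: "\<And>i j. i \<in> I \<Longrightarrow> j \<in> I \<Longrightarrow> r i j \<Longrightarrow> x i \<le> x j"
    and pos: "\<And>i. i \<in> I \<Longrightarrow> 0 \<le> x i"
    and bdd: "\<exists>B. \<forall>i\<in>I. norm (x i) \<le> B"
  shows "\<exists>l. \<forall>\<epsilon>>0. \<exists>i\<in>I. \<forall>j\<in>I. r i j \<longrightarrow> norm (x j - l) < \<epsilon>"
proof -
  have "directed_index (x ` I) (\<le>)"
    unfolding directed_index_def
  proof (intro conjI ballI impI)
    show "x ` I \<noteq> {}" using dir by (auto simp: directed_index_def)
  next
    fix a b assume "a \<in> x ` I" "b \<in> x ` I"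
    then obtain i j where ij: "i \<in> I" "j \<in> I" "a = x i" "b = x j" by blast
    then obtain k where "k \<in> I" "r i k" "r j k"
      using dir unfolding directed_index_def by meson
    then show "\<exists>c\<in>x ` I. a \<le> c \<and> b \<le> c" using ij mono by blast
  qed auto
  then have "\<exists>l. \<forall>\<epsilon>>0. \<exists>a\<in>x ` I. \<forall>b\<in>x ` I. a \<le> b \<longrightarrow> norm (b - l) < \<epsilon>"
    using pos bdd by (intro kb_self_indexed) auto
  then obtain l where l: "\<And>\<epsilon>. \<epsilon> > 0 \<Longrightarrow> \<exists>a\<in>x ` I. \<forall>b\<in>x ` I. a \<le> b \<longrightarrow> norm (b - l) < \<epsilon>"
    by auto
  have "\<exists>i\<in>I. \<forall>j\<in>I. r i j \<longrightarrow> norm (x j - l) < \<epsilon>" if "\<epsilon> > 0" for \<epsilon>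
    using l[OF that] mono by blast
  then show ?thesis by blast
qed


subsection \<open>The extended space\<close>

text \<open>
  \<^typ>\<open>'e top\<close> adjoins a largest element to \<open>'e\<close>. Its constructors are renamed because
  their base names are shadowed in the library by those of another type.
\<close>

abbreviation Finite :: "'e \<Rightarrow> 'e top" where "Finite \<equiv> top.Value"
abbreviation Infty :: "'e top" where "Infty \<equiv> top.Top"

instantiation top :: (comm_monoid_add) comm_monoid_add
begin

definition zero_top :: "'a top" where "0 = Finite 0"

fun plus_top :: "'a top \<Rightarrow> 'a top \<Rightarrow> 'a top" where
  "Finite a + Finite b = Finite (a + b)"
| "Infty + y = Infty"
| "Finite a + Infty = Infty"

instance
proof
  fix a b c :: "'a top"
  show "a + b + c = a + (b + c)" by (cases a; cases b; cases c) (simp_all add: add.assoc)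
  show "a + b = b + a" by (cases a; cases b) (simp_all add: add.commute)
  show "0 + a = a" by (cases a) (simp_all add: zero_top_def)
qed

end

text \<open>Only used for scalars \<open>r \<ge> 0\<close>.\<close>

fun scale_top :: "real \<Rightarrow> 'e::real_vector top \<Rightarrow> 'e top" where
  "scale_top r (Finite a) = Finite (r *\<^sub>R a)"
| "scale_top r Infty = (if r = 0 then 0 else Infty)"

text \<open>The element of \<open>'e\<close> underlying a finite element; arbitrary at infinity.\<close>

fun the_finite :: "'e top \<Rightarrow> 'e" where
  "the_finite (Finite a) = a"
| "the_finite Infty = undefined"


subsection \<open>Measures and the order integral\<close>

text \<open>
  An argument \<open>M :: 'x measure\<close> below only serves as a measurable space \<open>(space M, sets M)\<close>.
  A vector measure is an extensional function on \<^term>\<open>sets M\<close>, so that equality of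
  measures is equality on \<^term>\<open>sets M\<close>.
\<close>

definition positive_vector_measure ::
    "'x measure \<Rightarrow> ('x set \<Rightarrow> 'e::banach_lattice top) \<Rightarrow> bool" where
  "positive_vector_measure M \<mu> \<longleftrightarrow>
     \<mu> \<in> (sets M \<rightarrow>\<^sub>E {a. 0 \<le> a}) \<and> \<mu> {} = 0 \<and>
     (\<forall>A :: nat \<Rightarrow> 'x set. range A \<subseteq> sets M \<longrightarrow> disjoint_family A \<longrightarrow>
        isLub UNIV (range (\<lambda>N. \<Sum>n\<le>N. \<mu> (A n))) (\<mu> (\<Union>n. A n)))"

definition finite_vector_measure :: "'x measure \<Rightarrow> ('x set \<Rightarrow> 'e top) \<Rightarrow> bool" where
  "finite_vector_measure M \<mu> \<longleftrightarrow> \<mu> (space M) \<in> range Finite"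

definition elementary :: "'x measure \<Rightarrow> ('x \<Rightarrow> real) \<Rightarrow> bool" where
  "elementary M \<phi> \<longleftrightarrow> simple_function M \<phi> \<and> (\<forall>x\<in>space M. 0 \<le> \<phi> x)"

text \<open>
  As for \<^const>\<open>simple_integral\<close>, the canonical representation of the elementary function
  is used.
\<close>

definition elementary_integral ::
    "'x measure \<Rightarrow> ('x set \<Rightarrow> 'e::banach_lattice top) \<Rightarrow> ('x \<Rightarrow> real) \<Rightarrow> 'e top" where
  "elementary_integral M \<mu> \<phi> =
     (\<Sum>r\<in>\<phi> ` space M. scale_top r (\<mu> (\<phi> -` {r} \<inter> space M)))"

definition elementary_approx ::
    "'x measure \<Rightarrow> (nat \<Rightarrow> 'x \<Rightarrow> real) \<Rightarrow> ('x \<Rightarrow> ennreal) \<Rightarrow> bool" where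
  "elementary_approx M \<phi> f \<longleftrightarrow>
     (\<forall>n. elementary M (\<phi> n)) \<and>
     (\<forall>x\<in>space M. incseq (\<lambda>n. \<phi> n x) \<and> (\<lambda>n. ennreal (\<phi> n x)) \<longlonglongrightarrow> f x)"

text \<open>
  The description is definite whenever \<open>f\<close> is measurable, \<open>\<mu>\<close> is a positive vector measure
  and \<open>'e\<close> is Dedekind complete: the supremum exists and is the same for all approximating
  sequences.
\<close>

definition order_nn_integral ::
    "'x measure \<Rightarrow> ('x set \<Rightarrow> 'e::banach_lattice top) \<Rightarrow> ('x \<Rightarrow> ennreal) \<Rightarrow> 'e top" where
  "order_nn_integral M \<mu> f =
     (THE a. \<exists>\<phi>. elementary_approx M \<phi> f \<and>
        isLub UNIV (range (\<lambda>n. elementary_integral M \<mu> (\<phi> n))) a)"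

definition order_integrable ::
    "'x measure \<Rightarrow> ('x set \<Rightarrow> 'e::banach_lattice top) \<Rightarrow> ('x \<Rightarrow> real) \<Rightarrow> bool" where
  "order_integrable M \<mu> f \<longleftrightarrow>
     f \<in> borel_measurable M \<and>
     order_nn_integral M \<mu> (\<lambda>x. ennreal \<bar>f x\<bar>) \<in> range Finite"

definition order_integral ::
    "'x measure \<Rightarrow> ('x set \<Rightarrow> 'e::banach_lattice top) \<Rightarrow> ('x \<Rightarrow> real) \<Rightarrow> 'e" where
  "order_integral M \<mu> f =
     the_finite (order_nn_integral M \<mu> (\<lambda>x. ennreal (max (f x) 0))) -
     the_finite (order_nn_integral M \<mu> (\<lambda>x. ennreal (max (- f x) 0)))"


subsection \<open>Regular Borel measures\<close>

definition borel_of :: "'x topology \<Rightarrow> 'x measure" where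
  "borel_of X = sigma (topspace X) {U. openin X U}"

definition inner_regular_at ::
    "'x topology \<Rightarrow> ('x set \<Rightarrow> 'e::banach_lattice top) \<Rightarrow> 'x set \<Rightarrow> bool" where
  "inner_regular_at X \<mu> D \<longleftrightarrow> isLub UNIV {\<mu> K | K. compactin X K \<and> K \<subseteq> D} (\<mu> D)"

definition outer_regular_at ::
    "'x topology \<Rightarrow> ('x set \<Rightarrow> 'e::banach_lattice top) \<Rightarrow> 'x set \<Rightarrow> bool" where
  "outer_regular_at X \<mu> D \<longleftrightarrow> isGlb UNIV {\<mu> V | V. openin X V \<and> D \<subseteq> V} (\<mu> D)"

definition regular_borel_measure ::
    "'x topology \<Rightarrow> ('x set \<Rightarrow> 'e::banach_lattice top) \<Rightarrow> bool" where
  "regular_borel_measure X \<mu> \<longleftrightarrow>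
     positive_vector_measure (borel_of X) \<mu> \<and>
     (\<forall>K. compactin X K \<longrightarrow> \<mu> K \<in> range Finite) \<and>
     (\<forall>V. openin X V \<longrightarrow> inner_regular_at X \<mu> V) \<and>
     (\<forall>D\<in>sets (borel_of X). outer_regular_at X \<mu> D)"


subsection \<open>Function spaces\<close>

text \<open>
  A function on the space \<open>X\<close> is represented by the function on the ambient type that agrees
  with it on \<^term>\<open>topspace X\<close> and is zero elsewhere.
\<close>

definition C0 :: "'x topology \<Rightarrow> ('x \<Rightarrow> real) set" where
  "C0 X = {f. continuous_map X euclideanreal f \<and> (\<forall>x. x \<notin> topspace X \<longrightarrow> f x = 0) \<and>
              (\<forall>\<epsilon>>0. compactin X {x \<in> topspace X. \<epsilon> \<le> \<bar>f x\<bar>})}"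

definition supp_in :: "'x topology \<Rightarrow> ('x \<Rightarrow> real) \<Rightarrow> 'x set" where
  "supp_in X f = X closure_of {x \<in> topspace X. f x \<noteq> 0}"

definition Cc :: "'x topology \<Rightarrow> ('x \<Rightarrow> real) set" where
  "Cc X = {f. continuous_map X euclideanreal f \<and> (\<forall>x. x \<notin> topspace X \<longrightarrow> f x = 0) \<and>
              compactin X (supp_in X f)}"

definition prec_set :: "'x topology \<Rightarrow> ('x \<Rightarrow> real) \<Rightarrow> 'x set \<Rightarrow> bool" where
  "prec_set X f S \<longleftrightarrow>
     f \<in> Cc X \<and> (\<forall>x\<in>topspace X. 0 \<le> f x \<and> f x \<le> 1) \<and> supp_in X f \<subseteq> S"

definition set_prec :: "'x topology \<Rightarrow> 'x set \<Rightarrow> ('x \<Rightarrow> real) \<Rightarrow> bool" where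
  "set_prec X S f \<longleftrightarrow>
     f \<in> Cc X \<and> (\<forall>x\<in>topspace X. 0 \<le> f x \<and> f x \<le> 1) \<and> (\<forall>x\<in>S. f x = 1)"

definition positive_operator ::
    "('x \<Rightarrow> real) set \<Rightarrow> (('x \<Rightarrow> real) \<Rightarrow> 'e::banach_lattice) \<Rightarrow> bool" where
  "positive_operator F \<pi> \<longleftrightarrow>
     (\<forall>f\<in>F. \<forall>g\<in>F. \<pi> (\<lambda>x. f x + g x) = \<pi> f + \<pi> g) \<and>
     (\<forall>c. \<forall>f\<in>F. \<pi> (\<lambda>x. c * f x) = c *\<^sub>R \<pi> f) \<and>
     (\<forall>f\<in>F. (\<forall>x. 0 \<le> f x) \<longrightarrow> 0 \<le> \<pi> f)"

text \<open>The equation \<open>\<pi> f = \<integral> f d\<mu>\<close>, which includes that the integral is defined.\<close>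

definition represents_at ::
    "'x topology \<Rightarrow> ('x set \<Rightarrow> 'e::banach_lattice top) \<Rightarrow> (('x \<Rightarrow> real) \<Rightarrow> 'e) \<Rightarrow> ('x \<Rightarrow> real) \<Rightarrow> bool"
  where
  "represents_at X \<mu> \<pi> f \<longleftrightarrow>
     order_integrable (borel_of X) \<mu> f \<and> \<pi> f = order_integral (borel_of X) \<mu> f"

end

theory Submission
  imports Defs
begin

text \<open>
  The norm of a KB-space is order continuous, so suprema of directed sets are norm limits and the
  usual \<open>\<epsilon>\<close>-arguments can be carried out with norms. Put \<open>\<mu>(V) = sup {\<pi> f | f \<prec> V}\<close> for open \<open>V\<close>
  and \<open>\<mu>(A) = inf {\<mu>(V) | A \<subseteq> V}\<close>. On open sets \<open>\<mu>\<close> is subadditive (by Urysohn) and supermodular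
  (because \<open>f + g = max f g + min f g\<close>). The sets that lie between a closed \<open>F\<close> and an open \<open>V\<close> with
  \<open>\<mu>(V - F)\<close> small in norm form a \<open>\<sigma>\<close>-algebra containing the open sets, and on it the two inequalities
  give additivity. Slicing \<open>f\<close> horizontally shows \<open>\<pi> f = \<integral> f d\<mu>\<close>. Conversely, a representing regular
  measure is determined on open sets by inner regularity and Urysohn functions, hence everywhere by
  outer regularity.
\<close>

subsection \<open>Order and norm\<close>

text \<open>No hypothesis says that \<open>\<pi>\<close> is bounded. Positivity on all of
  \<open>C0 X\<close> forces it: unbounded values would accumulate on one geometric series, whose
  sum stays in \<open>C0 X\<close> because that space is closed under uniform limits. The bound is
  what makes the suprema defining \<open>\<mu>_open\<close> exist in \<open>E\<close>, so the
  constructed measure never takes the value infinity. That value has to be handled only for a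
  competing measure \<open>\<nu>\<close>, whose integrals are therefore computed on compact
  carriers, where it is finite.

  The order of \<open>E\<close> is partial, so an open set of nearly minimal measure cannot be
  selected by a scalar inequality. Instead an error is a positive element of small norm, and
  \<open>le_eps\<close> removes it at the end. The errors in the extension to Borel sets are values
  of \<open>\<mu>_open\<close> on gaps \<open>V - F\<close> that are open, hence within reach of the
  estimates for open sets.

  The order integral is a definite description over approximating sequences. Its value is usable
  only after one sequence has been compared with another, which is the purpose of
  \<open>simple_vector_integral_le_approx\<close>.\<close>

lemma isLub_UNIV_iff:
  "isLub UNIV S (l :: 'a::order) \<longleftrightarrow> (\<forall>x\<in>S. x \<le> l) \<and> (\<forall>b. (\<forall>x\<in>S. x \<le> b) \<longrightarrow> l \<le> b)"
  by (auto simp: isLub_def leastP_def isUb_def setle_def setge_def)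

lemma isGlb_UNIV_iff:
  "isGlb UNIV S (l :: 'a::order) \<longleftrightarrow> (\<forall>x\<in>S. l \<le> x) \<and> (\<forall>b. (\<forall>x\<in>S. b \<le> x) \<longrightarrow> b \<le> l)"
  by (auto simp: isGlb_def greatestP_def isLb_def setle_def setge_def)

lemma isLub_UNIV_unique: "isLub UNIV S (l :: 'a::order) \<Longrightarrow> isLub UNIV S l' \<Longrightarrow> l = l'"
  by (simp add: isLub_UNIV_iff order_antisym)

lemma isGlb_UNIV_unique: "isGlb UNIV S (l :: 'a::order) \<Longrightarrow> isGlb UNIV S l' \<Longrightarrow> l = l'"
  by (simp add: isGlb_UNIV_iff order_antisym)

lemma isLub_Finite_iff:
  fixes l :: "'a::order"
  assumes "S \<noteq> {}"
  shows "isLub UNIV (Finite ` S) (Finite l) \<longleftrightarrow> isLub UNIV S l"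
proof -
  have "(\<forall>b. (\<forall>x\<in>S. Finite x \<le> b) \<longrightarrow> Finite l \<le> b) \<longleftrightarrow> (\<forall>b. (\<forall>x\<in>S. x \<le> b) \<longrightarrow> l \<le> b)"
    by (metis less_eq_top_Top less_eq_top_Value_Value top.exhaust)
  then show ?thesis by (simp add: isLub_UNIV_iff)
qed

text \<open>Nonemptiness excludes the infimum of the empty set, which is infinity in the extended
  space: any element of \<open>S\<close> rules out an infinite lower bound.\<close>

lemma isGlb_Finite_iff:
  fixes l :: "'a::order"
  assumes "S \<noteq> {}"
  shows "isGlb UNIV (Finite ` S) (Finite l) \<longleftrightarrow> isGlb UNIV S l"
proof -
  have "(\<forall>b. (\<forall>x\<in>S. b \<le> Finite x) \<longrightarrow> b \<le> Finite l) \<longleftrightarrow> (\<forall>b. (\<forall>x\<in>S. b \<le> x) \<longrightarrow> b \<le> l)"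
    (is "?A = ?B")
  proof
    assume ?B
    show ?A
    proof (intro allI impI)
      fix b assume "\<forall>x\<in>S. b \<le> Finite x"
      with assms \<open>?B\<close> show "b \<le> Finite l" by (cases b) auto
    qed
  qed (metis less_eq_top_Value_Value)
  then show ?thesis by (simp add: isGlb_UNIV_iff)
qed

lemma norm_mono: "0 \<le> (x :: 'a::banach_lattice) \<Longrightarrow> x \<le> y \<Longrightarrow> norm x \<le> norm y"
  by (rule norm_mono_abs) (use order_trans in \<open>fastforce simp: abs_of_nonneg\<close>)

lemma norm_pprt_le: "(x :: 'a::banach_lattice) \<le> e \<Longrightarrow> norm (sup x 0) \<le> norm e"
  by (rule norm_mono_abs) (metis abs_ge_self abs_ge_zero abs_of_nonneg order_trans sup.cobounded2 sup_least)

text \<open>The positive cone of a Banach lattice is norm closed.\<close>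

lemma le_eps:
  fixes x :: "'a::banach_lattice"
  assumes "\<And>\<epsilon>. \<epsilon> > 0 \<Longrightarrow> \<exists>e. norm e < \<epsilon> \<and> x \<le> y + e"
  shows "x \<le> y"
proof -
  have "norm (sup (x - y) 0) \<le> 0"
  proof (rule field_le_epsilon)
    fix \<epsilon> :: real assume "0 < \<epsilon>"
    then obtain e where e: "norm e < \<epsilon>" "x \<le> y + e" using assms by blast
    then have "x - y \<le> e" by (simp add: algebra_simps)
    then show "norm (sup (x - y) 0) \<le> 0 + \<epsilon>" using norm_pprt_le e(1) by fastforce
  qed
  then have "sup (x - y) 0 = 0" by simp
  then have "x - y \<le> 0" by (metis sup.cobounded1)
  then show ?thesis by simp
qed

text \<open>Every upper bound \<open>b\<close> satisfies \<open>l \<le> b + (l - x)\<close> for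
  \<open>x\<close> in \<open>S\<close>, and \<open>l - x\<close> can be made small in norm.\<close>

lemma isLub_eps:
  fixes l :: "'a::banach_lattice"
  assumes "\<And>x. x \<in> S \<Longrightarrow> x \<le> l" "\<And>\<epsilon>. \<epsilon> > 0 \<Longrightarrow> \<exists>x\<in>S. norm (l - x) < \<epsilon>"
  shows "isLub UNIV S l"
  unfolding isLub_UNIV_iff
proof (intro conjI ballI allI impI)
  fix b assume b: "\<forall>x\<in>S. x \<le> b"
  show "l \<le> b"
  proof (rule le_eps)
    fix \<epsilon> :: real assume "0 < \<epsilon>"
    then obtain x where x: "x \<in> S" "norm (l - x) < \<epsilon>" using assms(2) by blast
    have "x + (l - x) \<le> b + (l - x)" using b x(1) by (intro add_right_mono) blast
    then show "\<exists>e. norm e < \<epsilon> \<and> l \<le> b + e" using x(2) by (intro exI[of _ "l - x"]) simp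
  qed
qed (use assms(1) in blast)

text \<open>\<open>S\<close> itself, ordered by \<open>\<le>\<close>, serves as the index set of an
  increasing net. Its norm limit dominates each \<open>x\<close>, because \<open>x\<close> lies
  below some late member \<open>z = l + (z - l)\<close>.\<close>

lemma kb_directed_lub:
  fixes S :: "'e::kb_space set"
  assumes ne: "S \<noteq> {}" and dir: "\<And>x y. x \<in> S \<Longrightarrow> y \<in> S \<Longrightarrow> \<exists>z\<in>S. x \<le> z \<and> y \<le> z"
    and pos: "\<And>x. x \<in> S \<Longrightarrow> 0 \<le> x" and bdd: "\<And>x. x \<in> S \<Longrightarrow> norm x \<le> B"
  obtains l where "isLub UNIV S l" "\<And>\<epsilon>. \<epsilon> > 0 \<Longrightarrow> \<exists>x\<in>S. norm (l - x) < \<epsilon>"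
proof -
  have "directed_index S (\<le>)"
    unfolding directed_index_def using ne dir by auto
  then have "\<exists>l. \<forall>\<epsilon>>0. \<exists>i\<in>S. \<forall>j\<in>S. i \<le> j \<longrightarrow> norm (j - l) < \<epsilon>"
    using kb_net_convergent[of S "(\<le>)" "\<lambda>x. x"] pos bdd by blast
  then obtain l where l: "\<And>\<epsilon>. \<epsilon> > 0 \<Longrightarrow> \<exists>i\<in>S. \<forall>j\<in>S. i \<le> j \<longrightarrow> norm (j - l) < \<epsilon>"
    by blast
  have "x \<le> l" if "x \<in> S" for x
  proof (rule le_eps)
    fix \<epsilon> :: real assume "0 < \<epsilon>"
    then obtain i where i: "i \<in> S" "\<forall>j\<in>S. i \<le> j \<longrightarrow> norm (j - l) < \<epsilon>" using l by blast
    obtain z where "z \<in> S" "x \<le> z" "i \<le> z" using dir \<open>x \<in> S\<close> i(1) by blast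
    then show "\<exists>e. norm e < \<epsilon> \<and> x \<le> l + e" using i(2) by (intro exI[of _ "z - l"]) simp
  qed
  moreover have "\<exists>x\<in>S. norm (l - x) < \<epsilon>" if "\<epsilon> > 0" for \<epsilon>
    using l[OF that] by (metis norm_minus_commute order_refl)
  ultimately show thesis using isLub_eps that by blast
qed

text \<open>Order continuity of the norm for a supremum that is already given: \<open>norm l\<close>
  bounds the set, so the KB limit exists, and it must coincide with \<open>l\<close>.\<close>

lemma kb_isLub_approx:
  fixes S :: "'e::kb_space set"
  assumes lub: "isLub UNIV S l" and "S \<noteq> {}" "\<And>x y. x \<in> S \<Longrightarrow> y \<in> S \<Longrightarrow> \<exists>z\<in>S. x \<le> z \<and> y \<le> z"
    and pos: "\<And>x. x \<in> S \<Longrightarrow> 0 \<le> x" and "\<epsilon> > 0"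
  shows "\<exists>x\<in>S. norm (l - x) < \<epsilon>"
proof -
  have "norm x \<le> norm l" if "x \<in> S" for x
    using lub that pos by (intro norm_mono) (auto simp: isLub_UNIV_iff)
  then obtain l' where "isLub UNIV S l'" "\<And>\<epsilon>. \<epsilon> > 0 \<Longrightarrow> \<exists>x\<in>S. norm (l' - x) < \<epsilon>"
    using kb_directed_lub[of S "norm l"] assms by blast
  then show ?thesis using isLub_UNIV_unique[OF lub] \<open>\<epsilon> > 0\<close> by blast
qed

subsection \<open>Elementary integrals of finite vector measures\<close>

text \<open>Values lie in the vector space itself rather than in the extended space, so that
  differences and norms are available for error estimates.\<close>

definition simple_vector_integral ::
    "'x measure \<Rightarrow> ('x set \<Rightarrow> 'e::real_vector) \<Rightarrow> ('x \<Rightarrow> real) \<Rightarrow> 'e" where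
  "simple_vector_integral M m \<phi> = (\<Sum>r\<in>\<phi> ` space M. r *\<^sub>R m (\<phi> -` {r} \<inter> space M))"

text \<open>Countable additivity enters only through \<open>exhaust\<close>, its norm form: what an
  increasing sequence leaves uncovered becomes small in norm.\<close>

locale fin_vmeasure =
  fixes M :: "'x measure" and m :: "'x set \<Rightarrow> 'e::banach_lattice"
  assumes nonneg: "\<And>A. A \<in> sets M \<Longrightarrow> 0 \<le> m A"
    and add: "\<And>A B. A \<in> sets M \<Longrightarrow> B \<in> sets M \<Longrightarrow> A \<inter> B = {} \<Longrightarrow> m (A \<union> B) = m A + m B"
    and exhaust: "\<And>A \<epsilon>. range A \<subseteq> sets M \<Longrightarrow> incseq (A :: nat \<Rightarrow> 'x set) \<Longrightarrow> (\<Union>n. A n) = space M \<Longrightarrow> \<epsilon> > 0 \<Longrightarrow>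
      \<exists>n. norm (m (space M - A n)) < \<epsilon>"
begin

lemma empty: "m {} = 0"
  using add[of "{}" "{}"] by simp

lemma mono: "A \<in> sets M \<Longrightarrow> B \<in> sets M \<Longrightarrow> A \<subseteq> B \<Longrightarrow> m A \<le> m B"
  using add[of A "B - A"] nonneg[of "B - A"] by (simp add: Un_absorb1)

lemma finite_additive:
  "finite I \<Longrightarrow> (\<And>i. i \<in> I \<Longrightarrow> A i \<in> sets M) \<Longrightarrow> disjoint_family_on A I \<Longrightarrow>
    m (\<Union>i\<in>I. A i) = (\<Sum>i\<in>I. m (A i))"
proof (induction I rule: finite_induct)
  case (insert i I)
  then have "A i \<inter> (\<Union>j\<in>I. A j) = {}" "disjoint_family_on A I"
    by (auto simp: disjoint_family_on_def)
  with insert show ?case by (simp add: add sets.finite_UN)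
qed (simp add: empty)

text \<open>Each level set of \<open>f\<close> is a finite disjoint union of fibres of
  \<open>g\<close>, so the canonical sum may be regrouped along any finer finite partition. Values
  in \<open>T\<close> that are not attained have empty fibres and contribute nothing.\<close>

lemma simple_vector_integral_partition:
  assumes T: "finite T" "g ` space M \<subseteq> T" "\<And>y. y \<in> T \<Longrightarrow> g -` {y} \<inter> space M \<in> sets M"
    and v: "\<And>x. x \<in> space M \<Longrightarrow> f x = v (g x)"
  shows "simple_vector_integral M m f = (\<Sum>y\<in>T. v y *\<^sub>R m (g -` {y} \<inter> space M))"
proof -
  let ?X = "space M" and ?T' = "{y\<in>T. v y \<in> f ` space M}"
  have fin: "finite (f ` ?X)"
    by (rule finite_subset[of _ "v ` T"]) (use T v in auto)
  have "r *\<^sub>R m (f -` {r} \<inter> ?X) = (\<Sum>y\<in>{y\<in>?T'. v y = r}. v y *\<^sub>R m (g -` {y} \<inter> ?X))"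
    if "r \<in> f ` ?X" for r
  proof -
    have "f -` {r} \<inter> ?X = (\<Union>y\<in>{y\<in>?T'. v y = r}. g -` {y} \<inter> ?X)"
      using T(2) v that by auto
    also have "m \<dots> = (\<Sum>y\<in>{y\<in>?T'. v y = r}. m (g -` {y} \<inter> ?X))"
      using T by (intro finite_additive) (auto simp: disjoint_family_on_def)
    finally show ?thesis by (simp add: scaleR_sum_right)
  qed
  then have "simple_vector_integral M m f
      = (\<Sum>r\<in>f ` ?X. \<Sum>y\<in>{y\<in>?T'. v y = r}. v y *\<^sub>R m (g -` {y} \<inter> ?X))"
    by (simp add: simple_vector_integral_def)
  also have "\<dots> = (\<Sum>y\<in>?T'. v y *\<^sub>R m (g -` {y} \<inter> ?X))"
    using T(1) fin by (intro sum.group) auto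
  also have "\<dots> = (\<Sum>y\<in>T. v y *\<^sub>R m (g -` {y} \<inter> ?X))"
  proof (rule sum.mono_neutral_left)
    show "\<forall>y\<in>T - ?T'. v y *\<^sub>R m (g -` {y} \<inter> ?X) = 0"
    proof
      fix y assume "y \<in> T - ?T'"
      then have "g -` {y} \<inter> ?X = {}" using v by auto
      then show "v y *\<^sub>R m (g -` {y} \<inter> ?X) = 0" by (simp add: empty)
    qed
  qed (use T in auto)
  finally show ?thesis .
qed

text \<open>The fibres of the pair map refine the level sets of both functions; over them, sums and
  comparisons become termwise.\<close>

lemma simple_vector_integral_pair:
  assumes "simple_function M \<phi>" "simple_function M \<psi>"
    and "\<And>x. x \<in> space M \<Longrightarrow> f x = v (\<phi> x) (\<psi> x)"
  shows "simple_vector_integral M m f = (\<Sum>(a, b)\<in>(\<lambda>x. (\<phi> x, \<psi> x)) ` space M.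
    v a b *\<^sub>R m ((\<lambda>x. (\<phi> x, \<psi> x)) -` {(a, b)} \<inter> space M))"
  using simple_function_Pair[OF assms(1,2)] assms(3)
  by (subst simple_vector_integral_partition[where v = "case_prod v" and g = "\<lambda>x. (\<phi> x, \<psi> x)"])
    (auto simp: simple_function_def split_def)

lemma simple_vector_integral_add:
  assumes "simple_function M \<phi>" "simple_function M \<psi>"
  shows "simple_vector_integral M m (\<lambda>x. \<phi> x + \<psi> x)
    = simple_vector_integral M m \<phi> + simple_vector_integral M m \<psi>"
  using simple_vector_integral_pair[OF assms, of "\<lambda>x. \<phi> x + \<psi> x" "\<lambda>a b. a + b"]
    simple_vector_integral_pair[OF assms, of \<phi> "\<lambda>a b. a"]
    simple_vector_integral_pair[OF assms, of \<psi> "\<lambda>a b. b"]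
  by (simp add: split_def scaleR_add_left sum.distrib)

lemma simple_vector_integral_mono:
  assumes "simple_function M \<phi>" "simple_function M \<psi>" "\<And>x. x \<in> space M \<Longrightarrow> \<phi> x \<le> \<psi> x"
  shows "simple_vector_integral M m \<phi> \<le> simple_vector_integral M m \<psi>"
proof -
  have *: "(\<lambda>x. (\<phi> x, \<psi> x)) -` {p} \<inter> space M \<in> sets M" if "p \<in> (\<lambda>x. (\<phi> x, \<psi> x)) ` space M" for p
    using simple_function_Pair[OF assms(1,2)] that by (auto simp: simple_function_def)
  show ?thesis
    using simple_vector_integral_pair[OF assms(1,2), of \<phi> "\<lambda>a b. a"]
      simple_vector_integral_pair[OF assms(1,2), of \<psi> "\<lambda>a b. b"] assms(3) *
    by (auto simp: split_def intro!: sum_mono scaleR_right_mono nonneg)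
qed

lemma simple_vector_integral_indicator:
  assumes "A \<in> sets M"
  shows "simple_vector_integral M m (\<lambda>x. c * indicator A x) = c *\<^sub>R m A"
proof -
  have eq: "(\<lambda>x. x \<in> A) -` {True} \<inter> space M = A" "(\<lambda>x. x \<in> A) -` {False} \<inter> space M = space M - A"
    using sets.sets_into_space[OF assms] by auto
  have "simple_vector_integral M m (\<lambda>x. c * indicator A x)
      = (\<Sum>y\<in>UNIV. (if y then c else 0) *\<^sub>R m ((\<lambda>x. x \<in> A) -` {y} \<inter> space M))"
  proof (rule simple_vector_integral_partition)
    show "(\<lambda>x. x \<in> A) -` {y} \<inter> space M \<in> sets M" for y
      by (cases y) (use eq assms in \<open>simp_all only: sets.compl_sets\<close>)
  qed (auto simp: indicator_def)
  also have "\<dots> = c *\<^sub>R m A" by (simp add: UNIV_bool eq)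
  finally show ?thesis .
qed

lemma simple_function_const_indicator: "A \<in> sets M \<Longrightarrow> simple_function M (\<lambda>x. c * indicator A x :: real)"
  by auto

lemma simple_vector_integral_sum_indicator:
  assumes "finite I" "\<And>i. i \<in> I \<Longrightarrow> A i \<in> sets M"
  shows "simple_vector_integral M m (\<lambda>x. \<Sum>i\<in>I. c i * indicator (A i) x) = (\<Sum>i\<in>I. c i *\<^sub>R m (A i))"
  using assms
proof (induction I rule: finite_induct)
  case empty
  then show ?case using simple_vector_integral_indicator[of "{}" 0] by simp
next
  case (insert i I)
  have "simple_vector_integral M m (\<lambda>x. \<Sum>i\<in>insert i I. c i * indicator (A i) x)
      = simple_vector_integral M m (\<lambda>x. c i * indicator (A i) x + (\<Sum>i\<in>I. c i * indicator (A i) x))"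
    by (simp only: sum.insert[OF insert(1,2)])
  also have "\<dots> = simple_vector_integral M m (\<lambda>x. c i * indicator (A i) x)
      + simple_vector_integral M m (\<lambda>x. \<Sum>i\<in>I. c i * indicator (A i) x)"
    using insert.prems
    by (intro simple_vector_integral_add simple_function_sum simple_function_const_indicator) blast+
  also have "simple_vector_integral M m (\<lambda>x. c i * indicator (A i) x) = c i *\<^sub>R m (A i)"
    using insert.prems by (intro simple_vector_integral_indicator) blast
  also have "simple_vector_integral M m (\<lambda>x. \<Sum>i\<in>I. c i * indicator (A i) x) = (\<Sum>i\<in>I. c i *\<^sub>R m (A i))"
    using insert.IH insert.prems by blast
  finally show ?case by (simp only: sum.insert[OF insert(1,2)])
qed

text \<open>
  Up to \<open>\<delta>\<close>, the function \<open>\<psi>\<close> is dominated by \<open>\<phi> n\<close> outside a set whose measure tends to zero in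
  norm.
\<close>

lemma simple_vector_integral_le_approx:
  assumes approx: "elementary_approx M \<phi> f" and \<psi>: "elementary M \<psi>"
    and le: "\<And>x. x \<in> space M \<Longrightarrow> ennreal (\<psi> x) \<le> f x"
    and L: "\<And>n. simple_vector_integral M m (\<phi> n) \<le> L"
  shows "simple_vector_integral M m \<psi> \<le> L"
proof (rule le_eps)
  fix \<epsilon> :: real assume "0 < \<epsilon>"
  let ?X = "space M"
  \<comment> \<open>The budget \<open>\<epsilon>\<close> is split in two: \<open>\<delta>\<close>
    times the norm of the total mass uses at most one half. The \<open>+ 1\<close> guards against
    total mass zero.\<close>
  define \<delta> where "\<delta> = \<epsilon> / (2 * (norm (m ?X) + 1))"
  have npos: "0 < norm (m ?X) + 1" by (simp add: add_nonneg_pos)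
  then have "0 < \<delta>" using \<open>0 < \<epsilon>\<close> by (simp add: \<delta>_def)
  have sf: "simple_function M (\<phi> n)" "simple_function M \<psi>" for n
    using approx \<psi> by (auto simp: elementary_approx_def elementary_def)
  note [measurable] = sf[THEN borel_measurable_simple_function]
  have "finite (\<psi> ` ?X)" using sf by (auto simp: simple_function_def)
  then obtain C0 where C0: "\<And>x. x \<in> ?X \<Longrightarrow> \<psi> x \<le> C0"
    by (meson bdd_above.unfold bdd_above_finite imageI)
  define C where "C = max C0 1"
  have C: "\<psi> x \<le> C" if "x \<in> ?X" for x using C0[OF that] by (simp add: C_def)
  have "C > 0" by (simp add: C_def)
  define A where "A n = {x \<in> ?X. \<psi> x - \<delta> < \<phi> n x}" for n
  have A [measurable]: "A n \<in> sets M" for n unfolding A_def by measurable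
  have inc: "incseq A"
    using approx by (auto simp: A_def elementary_approx_def incseq_def intro: less_le_trans)
  have "x \<in> (\<Union>n. A n)" if x: "x \<in> ?X" for x
  proof (rule ccontr)
    assume "x \<notin> (\<Union>n. A n)"
    then have lt: "\<phi> n x \<le> \<psi> x - \<delta>" for n using x by (auto simp: A_def not_less)
    have "0 \<le> \<phi> 0 x" using approx x by (auto simp: elementary_approx_def elementary_def)
    \<comment> \<open>\<open>ennreal\<close> sends negative reals to zero, so the contradiction
      below depends on this difference not being truncated.\<close>
    then have "0 \<le> \<psi> x - \<delta>" using lt order_trans by blast
    have "f x \<le> ennreal (\<psi> x - \<delta>)"
      using approx x lt by (intro LIMSEQ_le_const2[of "\<lambda>n. ennreal (\<phi> n x)"])
        (auto simp: elementary_approx_def intro: ennreal_leI)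
    then have "ennreal (\<psi> x) \<le> ennreal (\<psi> x - \<delta>)" using le[OF x] order_trans by blast
    then show False using \<open>0 \<le> \<psi> x - \<delta>\<close> \<open>0 < \<delta>\<close> by simp
  qed
  then have "(\<Union>n. A n) = ?X" by (auto simp: A_def)
  then obtain n where n: "norm (m (?X - A n)) < \<epsilon> / (2 * C)"
    using exhaust[of A "\<epsilon> / (2 * C)"] inc A \<open>0 < \<epsilon>\<close> \<open>C > 0\<close> by (auto simp: image_subset_iff)
  \<comment> \<open>On \<open>A n\<close> the excess of \<open>\<psi>\<close> over
    \<open>\<phi> n\<close> is below \<open>\<delta>\<close>. Off \<open>A n\<close> only the crude
    bound \<open>C\<close> is available, but there the measure is small.\<close>
  define e where "e = \<delta> *\<^sub>R m ?X + C *\<^sub>R m (?X - A n)"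
  have "simple_vector_integral M m \<psi> \<le> simple_vector_integral M m
      (\<lambda>x. \<phi> n x + (\<delta> * indicator ?X x + C * indicator (?X - A n) x))"
  proof (rule simple_vector_integral_mono)
    fix x assume x: "x \<in> ?X"
    have "0 \<le> \<phi> n x" using approx x by (auto simp: elementary_approx_def elementary_def)
    then show "\<psi> x \<le> \<phi> n x + (\<delta> * indicator ?X x + C * indicator (?X - A n) x)"
      using x C[OF x] \<open>0 < \<delta>\<close> by (cases "x \<in> A n") (auto simp: A_def)
  qed (use sf in \<open>auto intro!: simple_function_add simple_function_const_indicator\<close>)
  also have "\<dots> = simple_vector_integral M m (\<phi> n) + e"
    unfolding e_def
    by (subst simple_vector_integral_add, (auto intro!: simple_function_add simple_function_const_indicator sf)[2],
        subst simple_vector_integral_add, (auto intro!: simple_function_const_indicator)[2])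
      (simp add: simple_vector_integral_indicator)
  also have "\<dots> \<le> L + e" using L by simp
  finally have "simple_vector_integral M m \<psi> \<le> L + e" .
  moreover have "norm e < \<epsilon>"
  proof -
    have "norm e \<le> \<delta> * norm (m ?X) + C * norm (m (?X - A n))"
      unfolding e_def using \<open>0 < \<delta>\<close> \<open>0 < C\<close> by (intro order_trans[OF norm_triangle_ineq]) simp
    moreover have "\<delta> * norm (m ?X) \<le> \<delta> * (norm (m ?X) + 1)" using \<open>0 < \<delta>\<close> by simp
    moreover have "\<delta> * (norm (m ?X) + 1) = \<epsilon> / 2" using npos by (simp add: \<delta>_def field_simps)
    moreover have "C * norm (m (?X - A n)) < \<epsilon> / 2" using n \<open>C > 0\<close> by (simp add: field_simps)
    ultimately show ?thesis by linarith
  qed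
  ultimately show "\<exists>e. norm e < \<epsilon> \<and> simple_vector_integral M m \<psi> \<le> L + e" by blast
qed

end

lemma sum_Finite: "(\<Sum>i\<in>I. Finite (f i)) = Finite (\<Sum>i\<in>I. f i)"
  by (induction I rule: infinite_finite_induct) (simp_all add: zero_top_def)

text \<open>The level \<open>r = 0\<close> is exempt because zero times infinity is zero: the zero
  set of an elementary function may have infinite measure.\<close>

lemma elementary_integral_Finite:
  assumes "\<And>r. r \<in> \<phi> ` space M \<Longrightarrow> r \<noteq> 0 \<Longrightarrow> \<nu> (\<phi> -` {r} \<inter> space M) = Finite (m (\<phi> -` {r} \<inter> space M))"
  shows "elementary_integral M \<nu> \<phi> = Finite (simple_vector_integral M m \<phi>)"
proof -
  have "scale_top r (\<nu> (\<phi> -` {r} \<inter> space M)) = Finite (r *\<^sub>R m (\<phi> -` {r} \<inter> space M))"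
    if "r \<in> \<phi> ` space M" for r
  proof (cases "r = 0")
    case True
    then show ?thesis by (cases "\<nu> (\<phi> -` {r} \<inter> space M)") (simp_all add: zero_top_def)
  qed (simp add: assms that)
  then show ?thesis
    unfolding elementary_integral_def simple_vector_integral_def sum_Finite[symmetric]
    by (intro sum.cong refl)
qed

subsection \<open>Vector measures\<close>

lemma top_add_increasing: "0 \<le> b \<Longrightarrow> a \<le> a + (b :: 'e::ordered_ab_group_add top)"
  by (cases a; cases b) (simp_all add: zero_top_def)

locale vmeasure =
  fixes M :: "'x measure" and \<nu> :: "'x set \<Rightarrow> 'e::kb_space top"
  assumes pvm: "positive_vector_measure M \<nu>"
begin

lemma nonneg: "A \<in> sets M \<Longrightarrow> 0 \<le> \<nu> A"
  using pvm by (auto simp: positive_vector_measure_def)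

lemma empty: "\<nu> {} = 0"
  using pvm by (simp add: positive_vector_measure_def)

text \<open>The sequence \<open>A, B, {}, {}, ...\<close> has only the partial sums
  \<open>\<nu> A\<close> and \<open>\<nu> A + \<nu> B\<close>, and the second is the larger
  one.\<close>

lemma add:
  assumes "A \<in> sets M" "B \<in> sets M" "A \<inter> B = {}"
  shows "\<nu> (A \<union> B) = \<nu> A + \<nu> B"
proof -
  have sums: "(\<Sum>n\<le>N. \<nu> (binaryset A B n)) = (if N = 0 then \<nu> A else \<nu> A + \<nu> B)" for N
  proof (induction N)
    case (Suc N)
    then show ?case by (cases N) (simp_all add: binaryset_def empty)
  qed (simp add: binaryset_def)
  have "disjoint_family (binaryset A B)"
    using assms(3) by (auto simp: disjoint_family_on_def binaryset_def)
  moreover have "range (binaryset A B) \<subseteq> sets M"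
    using assms by (auto simp: range_binaryset_eq)
  ultimately have "isLub UNIV (range (\<lambda>N. \<Sum>n\<le>N. \<nu> (binaryset A B n))) (\<nu> (\<Union>n. binaryset A B n))"
    using pvm unfolding positive_vector_measure_def by blast
  then have 1: "isLub UNIV (range (\<lambda>N. if N = (0::nat) then \<nu> A else \<nu> A + \<nu> B)) (\<nu> (A \<union> B))"
    by (simp only: sums UN_binaryset_eq)
  have "range (\<lambda>N. if N = (0::nat) then \<nu> A else \<nu> A + \<nu> B) = {\<nu> A, \<nu> A + \<nu> B}"
    by (auto simp: image_iff)
  then have "isLub UNIV (range (\<lambda>N. if N = (0::nat) then \<nu> A else \<nu> A + \<nu> B)) (\<nu> A + \<nu> B)"
    using top_add_increasing nonneg[OF assms(2)] by (simp add: isLub_UNIV_iff)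
  with 1 show ?thesis by (rule isLub_UNIV_unique)
qed

lemma mono: "A \<in> sets M \<Longrightarrow> B \<in> sets M \<Longrightarrow> A \<subseteq> B \<Longrightarrow> \<nu> A \<le> \<nu> B"
  using add[of A "B - A"] nonneg[of "B - A"] by (simp add: Un_absorb1 top_add_increasing)

end

text \<open>
  In the uniqueness proof \<open>\<nu>\<close> may take the value infinity, but integrals of functions that vanish
  off \<open>K\<close> only see the trace of \<open>\<nu>\<close> on \<open>K\<close>.
\<close>

locale vmeasure_trace = vmeasure +
  fixes K
  assumes K: "K \<in> sets M" and K_finite: "\<nu> K \<in> range Finite"
begin

definition trace :: "'a set \<Rightarrow> 'b" where
  "trace A = the_finite (\<nu> (A \<inter> K))"

lemma Finite_trace:
  assumes "A \<in> sets M"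
  shows "Finite (trace A) = \<nu> (A \<inter> K)"
proof -
  have "\<nu> (A \<inter> K) \<le> \<nu> K" using assms K by (intro mono) auto
  then show ?thesis using K_finite by (cases "\<nu> (A \<inter> K)") (auto simp: trace_def)
qed

lemma trace_add:
  assumes "A \<in> sets M" "B \<in> sets M" "A \<inter> B = {}"
  shows "trace (A \<union> B) = trace A + trace B"
proof -
  have "Finite (trace (A \<union> B)) = \<nu> ((A \<inter> K) \<union> (B \<inter> K))"
    using assms by (simp add: Finite_trace Int_Un_distrib2)
  also have "\<dots> = Finite (trace A) + Finite (trace B)"
    using assms K by (subst add) (auto simp: Finite_trace)
  finally show ?thesis by simp
qed

lemma trace_nonneg: "A \<in> sets M \<Longrightarrow> 0 \<le> trace A"
  using nonneg[of "A \<inter> K"] K by (simp add: zero_top_def flip: Finite_trace)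

text \<open>Countable additivity on the successive differences of \<open>A\<close>, cut down to
  \<open>K\<close>, makes \<open>trace (space M)\<close> the supremum of the
  \<open>trace (A N)\<close>; the KB property upgrades this to norm convergence.\<close>

lemma trace_exhaust:
  fixes A :: "nat \<Rightarrow> 'a set"
  assumes A: "range A \<subseteq> sets M" "incseq A" "(\<Union>n. A n) = space M" and "\<epsilon> > 0"
  shows "\<exists>n. norm (trace (space M - A n)) < \<epsilon>"
proof -
  define D where "D n = disjointed A n \<inter> K" for n
  have dA: "disjointed A n \<in> sets M" for n
    using sets.range_disjointed_sets[OF A(1)] by auto
  have A': "A n \<in> sets M" for n using A(1) by auto
  have "disjoint_family (\<lambda>n. disjointed A n)" by (rule disjoint_family_disjointed)
  then have "disjoint_family D" by (auto simp: D_def disjoint_family_on_def)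
  moreover have "range D \<subseteq> sets M" using dA K by (auto simp: D_def)
  ultimately have "isLub UNIV (range (\<lambda>N. \<Sum>n\<le>N. \<nu> (D n))) (\<nu> (\<Union>n. D n))"
    using pvm unfolding positive_vector_measure_def by blast
  moreover have "(\<Union>n. D n) = space M \<inter> K"
  proof -
    have "(\<Union>n. D n) = (\<Union>n. disjointed A n) \<inter> K" by (auto simp: D_def)
    then show ?thesis using A(3) by (simp add: UN_disjointed_eq)
  qed
  moreover have "(\<Sum>n\<le>N. \<nu> (D n)) = Finite (trace (A N))" for N
  proof (induction N)
    case 0
    then show ?case using A' by (simp add: D_def disjointed_def Finite_trace)
  next
    case (Suc N)
    have "disjointed A (Suc N) = A (Suc N) - A N"
      using A(2) by (rule disjointed_mono)
    moreover have "trace (A (Suc N)) = trace (A N) + trace (A (Suc N) - A N)"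
      using trace_add[of "A N" "A (Suc N) - A N"] A' incseqD[OF A(2), of N "Suc N"] by (simp add: Un_absorb1)
    ultimately show ?case using Suc A' by (simp add: D_def flip: Finite_trace)
  qed
  ultimately have "isLub UNIV (Finite ` range (\<lambda>N. trace (A N))) (Finite (trace (space M)))"
    by (simp add: Finite_trace image_image)
  then have lub: "isLub UNIV (range (\<lambda>N. trace (A N))) (trace (space M))"
    by (subst (asm) isLub_Finite_iff) auto
  have mono: "trace (A i) \<le> trace (A j)" if "i \<le> j" for i j
    using trace_add[of "A i" "A j - A i"] trace_nonneg[of "A j - A i"] A' incseqD[OF A(2) that]
    by (simp add: Un_absorb1)
  have "\<exists>x\<in>range (\<lambda>N. trace (A N)). norm (trace (space M) - x) < \<epsilon>"
  proof (rule kb_isLub_approx[OF lub])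
    fix x y assume "x \<in> range (\<lambda>N. trace (A N))" "y \<in> range (\<lambda>N. trace (A N))"
    then obtain i j where "x = trace (A i)" "y = trace (A j)" by blast
    then show "\<exists>z\<in>range (\<lambda>N. trace (A N)). x \<le> z \<and> y \<le> z"
      using mono[of i "max i j"] mono[of j "max i j"] by auto
  qed (use A' trace_nonneg \<open>\<epsilon> > 0\<close> in auto)
  then obtain N where "norm (trace (space M) - trace (A N)) < \<epsilon>" by auto
  moreover have "trace (space M) = trace (A N) + trace (space M - A N)"
    using trace_add[of "A N" "space M - A N"] A' sets.sets_into_space[OF A'[of N]] by (simp add: Un_absorb1)
  ultimately show ?thesis by (metis add_diff_cancel_left')
qed

sublocale trace: fin_vmeasure M trace
  by unfold_locales (fact trace_nonneg trace_add trace_exhaust)+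

lemma elementary_integral_trace:
  assumes "elementary M \<phi>" "\<And>x. x \<in> space M - K \<Longrightarrow> \<phi> x = 0"
  shows "elementary_integral M \<nu> \<phi> = Finite (simple_vector_integral M trace \<phi>)"
proof (rule elementary_integral_Finite)
  fix r assume r: "r \<in> \<phi> ` space M" "r \<noteq> 0"
  then have "\<phi> -` {r} \<inter> space M \<in> sets M"
    using assms(1) by (auto simp: elementary_def simple_function_def)
  moreover have "\<phi> -` {r} \<inter> space M \<subseteq> K"
    using assms(2) r(2) by fastforce
  then have "\<phi> -` {r} \<inter> space M \<inter> K = \<phi> -` {r} \<inter> space M"
    by blast
  ultimately show "\<nu> (\<phi> -` {r} \<inter> space M) = Finite (trace (\<phi> -` {r} \<inter> space M))"
    using Finite_trace by metis
qed

lemma elementary_approx_le: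
  assumes "elementary_approx M \<phi> f" "x \<in> space M"
  shows "ennreal (\<phi> n x) \<le> f x"
proof (rule incseq_le)
  show "incseq (\<lambda>n. ennreal (\<phi> n x))"
    using assms unfolding elementary_approx_def incseq_def by (simp add: ennreal_leI)
qed (use assms in \<open>simp add: elementary_approx_def\<close>)

text \<open>The description is definite because any two approximating sequences dominate each
  other's suprema. A competing supremum is first bounded by \<open>Finite L\<close>, which also
  shows that it is finite.\<close>

lemma order_nn_integral_eq:
  assumes \<phi>: "elementary_approx M \<phi> f" and f: "\<And>x. x \<in> space M - K \<Longrightarrow> f x = 0"
    and L: "isLub UNIV (range (\<lambda>n. simple_vector_integral M trace (\<phi> n))) L"
  shows "order_nn_integral M \<nu> f = Finite L"
proof -
  have trace: "elementary_integral M \<nu> (\<psi> n) = Finite (simple_vector_integral M trace (\<psi> n))"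
    if "elementary_approx M \<psi> f" for \<psi> n
  proof (rule elementary_integral_trace)
    show el: "elementary M (\<psi> n)" using that by (simp add: elementary_approx_def)
    fix x assume x: "x \<in> space M - K"
    then have "ennreal (\<psi> n x) \<le> 0" using elementary_approx_le[OF that, of x n] f[OF x] by simp
    then show "\<psi> n x = 0" using el x by (auto simp: elementary_def ennreal_eq_0_iff)
  qed
  have le: "simple_vector_integral M trace (\<psi> k) \<le> L'"
    if "elementary_approx M \<psi> f" "elementary_approx M \<psi>' f"
      "\<And>n. simple_vector_integral M trace (\<psi>' n) \<le> L'" for \<psi> \<psi>' k L'
  proof (rule trace.simple_vector_integral_le_approx[OF that(2)])
    show "elementary M (\<psi> k)" using that(1) by (simp add: elementary_approx_def)
  qed (use that elementary_approx_le in blast)+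
  show ?thesis
    unfolding order_nn_integral_def
  proof (rule the_equality)
    have "isLub UNIV (Finite ` range (\<lambda>n. simple_vector_integral M trace (\<phi> n))) (Finite L)"
      using L by (subst isLub_Finite_iff) auto
    then show "\<exists>\<phi>. elementary_approx M \<phi> f \<and> isLub UNIV (range (\<lambda>n. elementary_integral M \<nu> (\<phi> n))) (Finite L)"
      using \<phi> by (intro exI[of _ \<phi>]) (simp add: trace[OF \<phi>] image_image)
  next
    fix a assume "\<exists>\<psi>. elementary_approx M \<psi> f \<and> isLub UNIV (range (\<lambda>n. elementary_integral M \<nu> (\<psi> n))) a"
    then obtain \<psi> where \<psi>: "elementary_approx M \<psi> f"
      and "isLub UNIV (range (\<lambda>n. elementary_integral M \<nu> (\<psi> n))) a"
      by blast
    then have a: "isLub UNIV (range (\<lambda>n. Finite (simple_vector_integral M trace (\<psi> n)))) a"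
      by (simp add: trace[OF \<psi>])
    have "simple_vector_integral M trace (\<psi> n) \<le> L" for n
      using le[OF \<psi> \<phi>] L by (auto simp: isLub_UNIV_iff)
    then have "a \<le> Finite L" using a by (auto simp: isLub_UNIV_iff)
    then obtain L' where L': "a = Finite L'" "L' \<le> L" by (cases a) auto
    then have "simple_vector_integral M trace (\<phi> n) \<le> L'" for n
      using le[OF \<phi> \<psi>] a by (auto simp: isLub_UNIV_iff)
    then have "L \<le> L'" using L by (auto simp: isLub_UNIV_iff)
    then show "a = Finite L" using L' by simp
  qed
qed

end

subsection \<open>Dyadic approximation\<close>

text \<open>For \<open>0 \<le> f \<le> N\<close> this is \<open>f\<close> rounded down to a multiple
  of \<open>1 / 2 ^ n\<close>. Written as a sum over superlevel sets rather than with a floor, it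
  has a layer sum as its integral, which can be compared slice by slice with
  \<open>\<pi> f\<close>.\<close>

definition dyadic :: "'x measure \<Rightarrow> nat \<Rightarrow> ('x \<Rightarrow> real) \<Rightarrow> nat \<Rightarrow> 'x \<Rightarrow> real" where
  "dyadic M N f n x =
     (\<Sum>k\<in>{1..N * 2 ^ n}. 1 / 2 ^ n * indicator {x \<in> space M. real k / 2 ^ n \<le> f x} x)"

text \<open>The sum counts the \<open>k \<ge> 1\<close> with \<open>k \<le> 2 ^ n * f x\<close>; the
  cap \<open>N * 2 ^ n\<close> loses none of them because \<open>f x \<le> N\<close>.\<close>

lemma dyadic_eq_floor:
  assumes "x \<in> space M" "0 \<le> f x" "f x \<le> real N"
  shows "dyadic M N f n x = of_int \<lfloor>2 ^ n * f x\<rfloor> / 2 ^ n"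
proof -
  let ?t = "2 ^ n * f x"
  have t: "0 \<le> ?t" "?t \<le> real (N * 2 ^ n)"
    using assms by (auto simp: mult.commute intro: mult_left_mono)
  have le: "k \<le> N * 2 ^ n" if "real k \<le> ?t" for k :: nat
    using order_trans[OF that t(2)] by (simp only: of_nat_le_iff)
  have "(\<Sum>k\<in>{1..N * 2 ^ n}. indicator {x \<in> space M. real k / 2 ^ n \<le> f x} x)
      = (\<Sum>k\<in>{1..N * 2 ^ n}. if real k \<le> ?t then 1 else (0::real))"
    using assms(1) by (intro sum.cong) (auto simp: indicator_def field_simps)
  also have "\<dots> = real (card {k\<in>{1..N * 2 ^ n}. real k \<le> ?t})"
    by (simp add: sum.If_cases Int_def)
  also have "{k\<in>{1..N * 2 ^ n}. real k \<le> ?t} = {1..nat \<lfloor>?t\<rfloor>}"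
    using t(1) le by (auto simp: le_nat_iff le_floor_iff)
  also have "real (card \<dots>) = of_int \<lfloor>?t\<rfloor>" using t(1) by simp
  finally show ?thesis unfolding dyadic_def by (simp flip: sum_distrib_left sum_divide_distrib)
qed

lemma elementary_approx_dyadic:
  assumes [measurable]: "f \<in> borel_measurable M"
    and f: "\<And>x. x \<in> space M \<Longrightarrow> 0 \<le> f x" "\<And>x. x \<in> space M \<Longrightarrow> f x \<le> real N"
  shows "elementary_approx M (dyadic M N f) (\<lambda>x. ennreal (f x))"
  unfolding elementary_approx_def
proof (intro conjI allI ballI)
  fix n
  have "simple_function M (dyadic M N f n)"
    unfolding dyadic_def[abs_def]
    by (intro simple_function_sum simple_function_mult simple_function_const simple_function_indicator)
      measurable
  then show "elementary M (dyadic M N f n)"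
    by (auto simp: elementary_def dyadic_def intro!: sum_nonneg)
next
  fix x assume x: "x \<in> space M"
  note eq = dyadic_eq_floor[where f = f, OF x f(1)[OF x] f(2)[OF x]]
  show "incseq (\<lambda>n. dyadic M N f n x)"
  proof (rule incseq_SucI)
    fix n
    \<comment> \<open>The grid of step \<open>n + 1\<close> refines that of step \<open>n\<close>,
      so rounding down on it cannot give less.\<close>
    have "2 * \<lfloor>2 ^ n * f x\<rfloor> \<le> \<lfloor>2 ^ Suc n * f x\<rfloor>"
      by (simp add: le_floor_iff mult.assoc)
    then have "2 * real_of_int \<lfloor>2 ^ n * f x\<rfloor> \<le> real_of_int \<lfloor>2 ^ Suc n * f x\<rfloor>"
      by linarith
    then show "dyadic M N f n x \<le> dyadic M N f (Suc n) x"
      unfolding eq by (simp add: field_simps)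
  qed
  have "(\<lambda>n. dyadic M N f n x) \<longlonglongrightarrow> f x"
  proof (rule real_tendsto_sandwich)
    show "\<forall>\<^sub>F n in sequentially. f x - 1 / 2 ^ n \<le> dyadic M N f n x"
    proof (intro always_eventually allI)
      fix n
      have "2 ^ n * f x - 1 \<le> of_int \<lfloor>2 ^ n * f x\<rfloor>" by linarith
      then have "(2 ^ n * f x - 1) / 2 ^ n \<le> of_int \<lfloor>2 ^ n * f x\<rfloor> / 2 ^ n"
        by (rule divide_right_mono) simp
      then show "f x - 1 / 2 ^ n \<le> dyadic M N f n x" unfolding eq by (simp add: diff_divide_distrib)
    qed
    show "\<forall>\<^sub>F n in sequentially. dyadic M N f n x \<le> f x"
    proof (intro always_eventually allI)
      fix n
      have "of_int \<lfloor>2 ^ n * f x\<rfloor> \<le> 2 ^ n * f x" by linarith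
      then show "dyadic M N f n x \<le> f x" unfolding eq by (simp add: field_simps)
    qed
    have "(\<lambda>n. f x - (1 / 2) ^ n) \<longlonglongrightarrow> f x - 0"
      by (intro tendsto_intros LIMSEQ_realpow_zero) auto
    then show "(\<lambda>n. f x - 1 / 2 ^ n) \<longlonglongrightarrow> f x" by (simp add: power_one_over)
  qed simp
  then show "(\<lambda>n. ennreal (dyadic M N f n x)) \<longlonglongrightarrow> ennreal (f x)"
    by (rule tendsto_ennrealI)
qed

context vmeasure_trace
begin

text \<open>The dyadic sums increase and stay below the integral of the constant \<open>N\<close>,
  which is finite against the trace. The comparison clauses spare later estimates another look at
  approximating sequences.\<close>

lemma order_nn_integral_bounded:
  assumes f: "f \<in> borel_measurable M" "\<And>x. x \<in> space M \<Longrightarrow> 0 \<le> f x" "\<And>x. x \<in> space M \<Longrightarrow> f x \<le> real N"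
    and off: "\<And>x. x \<in> space M - K \<Longrightarrow> f x = 0"
  obtains L where "order_nn_integral M \<nu> (\<lambda>x. ennreal (f x)) = Finite L"
    "\<And>\<psi>. elementary M \<psi> \<Longrightarrow> (\<And>x. x \<in> space M \<Longrightarrow> f x \<le> \<psi> x) \<Longrightarrow> L \<le> simple_vector_integral M trace \<psi>"
    "\<And>\<psi>. elementary M \<psi> \<Longrightarrow> (\<And>x. x \<in> space M \<Longrightarrow> \<psi> x \<le> f x) \<Longrightarrow> simple_vector_integral M trace \<psi> \<le> L"
proof -
  let ?I = "simple_vector_integral M trace" and ?\<phi> = "dyadic M N f"
  have approx: "elementary_approx M ?\<phi> (\<lambda>x. ennreal (f x))"
    using f by (rule elementary_approx_dyadic)
  then have sf: "simple_function M (?\<phi> n)" for n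
    by (simp add: elementary_approx_def elementary_def)
  have \<phi>f: "?\<phi> n x \<le> f x" if "x \<in> space M" for n x
    using elementary_approx_le[OF approx that, of n] f(2)[OF that] by simp
  have mono: "?I (?\<phi> i) \<le> ?I (?\<phi> j)" if "i \<le> j" for i j
    using approx that sf by (intro trace.simple_vector_integral_mono) (auto simp: elementary_approx_def incseq_def)
  have pos: "0 \<le> ?I (?\<phi> n)" for n
    using trace.simple_vector_integral_mono[of "\<lambda>x. 0 * indicator {} x" "?\<phi> n"] sf approx
      trace.simple_vector_integral_indicator[of "{}" 0]
    by (simp add: elementary_approx_def elementary_def)
  have le: "?I (?\<phi> n) \<le> ?I \<psi>" if "elementary M \<psi>" "\<And>x. x \<in> space M \<Longrightarrow> f x \<le> \<psi> x" for \<psi> n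
    using that(1) sf order_trans[OF \<phi>f that(2)]
    by (intro trace.simple_vector_integral_mono) (auto simp: elementary_def)
  have "elementary M (\<lambda>x. real N)" by (simp add: elementary_def)
  then have bdd: "norm (?I (?\<phi> n)) \<le> norm (?I (\<lambda>x. real N))" for n
    using pos le f by (intro norm_mono) auto
  obtain L where L: "isLub UNIV (range (\<lambda>n. ?I (?\<phi> n))) L"
  proof (rule kb_directed_lub[of "range (\<lambda>n. ?I (?\<phi> n))"])
    fix x y assume "x \<in> range (\<lambda>n. ?I (?\<phi> n))" "y \<in> range (\<lambda>n. ?I (?\<phi> n))"
    then obtain i j where "x = ?I (?\<phi> i)" "y = ?I (?\<phi> j)" by blast
    then show "\<exists>z\<in>range (\<lambda>n. ?I (?\<phi> n)). x \<le> z \<and> y \<le> z"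
      using mono[of i "max i j"] mono[of j "max i j"] by auto
  qed (use pos bdd in auto)
  show thesis
  proof
    show "order_nn_integral M \<nu> (\<lambda>x. ennreal (f x)) = Finite L"
      using approx _ L by (rule order_nn_integral_eq) (simp add: off)
    show "L \<le> ?I \<psi>" if "elementary M \<psi>" "\<And>x. x \<in> space M \<Longrightarrow> f x \<le> \<psi> x" for \<psi>
      using L le[OF that] by (auto simp: isLub_UNIV_iff)
    show "?I \<psi> \<le> L" if "elementary M \<psi>" "\<And>x. x \<in> space M \<Longrightarrow> \<psi> x \<le> f x" for \<psi>
      using approx that(1) ennreal_leI[OF that(2)]
      by (rule trace.simple_vector_integral_le_approx) (use L in \<open>auto simp: isLub_UNIV_iff\<close>)
  qed
qed

end

subsection \<open>Continuous functions on locally compact Hausdorff spaces\<close>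

lemma closedin_level:
  assumes "continuous_map X euclideanreal f"
  shows "closedin X {x \<in> topspace X. c \<le> f x}" "closedin X {x \<in> topspace X. f x \<le> c}"
  using closedin_continuous_map_preimage[OF assms, of "{c..}"]
    closedin_continuous_map_preimage[OF assms, of "{..c}"] by simp_all

lemma C0_continuous: "f \<in> C0 X \<Longrightarrow> continuous_map X euclideanreal f"
  and C0_off: "f \<in> C0 X \<Longrightarrow> x \<notin> topspace X \<Longrightarrow> f x = 0"
  and compactin_C0_level: "f \<in> C0 X \<Longrightarrow> 0 < \<epsilon> \<Longrightarrow> compactin X {x \<in> topspace X. \<epsilon> \<le> \<bar>f x\<bar>}"
  unfolding C0_def by blast+

lemma C0_level:
  assumes "f \<in> C0 X" "0 < \<epsilon>"
  obtains K where "compactin X K" "\<And>x. x \<in> topspace X \<Longrightarrow> \<epsilon> \<le> \<bar>f x\<bar> \<Longrightarrow> x \<in> K"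
  using compactin_C0_level[OF assms] that by blast

text \<open>A compact superset of each level set suffices, as the level sets of
  \<open>\<bar>f\<bar>\<close> are closed by continuity.\<close>

lemma C0I:
  assumes f: "continuous_map X euclideanreal f" "\<And>x. x \<notin> topspace X \<Longrightarrow> f x = 0"
    and level: "\<And>\<epsilon>. \<epsilon> > 0 \<Longrightarrow> \<exists>K. compactin X K \<and> (\<forall>x\<in>topspace X. \<epsilon> \<le> \<bar>f x\<bar> \<longrightarrow> x \<in> K)"
  shows "f \<in> C0 X"
proof -
  have "compactin X {x \<in> topspace X. \<epsilon> \<le> \<bar>f x\<bar>}" if "\<epsilon> > 0" for \<epsilon>
  proof -
    from level[OF that] obtain K where
      K: "compactin X K" "\<forall>x\<in>topspace X. \<epsilon> \<le> \<bar>f x\<bar> \<longrightarrow> x \<in> K" by (elim exE conjE)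
    have cl: "closedin X {x \<in> topspace X. \<epsilon> \<le> \<bar>f x\<bar>}"
      using f(1) by (intro closedin_level(1) continuous_map_real_abs)
    show ?thesis using K(1) _ cl by (rule closed_compactin) (use K(2) in blast)
  qed
  then show ?thesis unfolding C0_def using f by blast
qed

lemma C0_dominated:
  assumes f: "f \<in> C0 X" and "continuous_map X euclideanreal g" "\<And>x. x \<notin> topspace X \<Longrightarrow> g x = 0"
    and "0 < c" and le: "\<And>x. \<bar>g x\<bar> \<le> c * \<bar>f x\<bar>"
  shows "g \<in> C0 X"
proof (rule C0I)
  fix \<epsilon> :: real assume "0 < \<epsilon>"
  then have "\<epsilon> / c > 0" using \<open>0 < c\<close> by simp
  then obtain K where K: "compactin X K" "\<And>x. x \<in> topspace X \<Longrightarrow> \<epsilon> / c \<le> \<bar>f x\<bar> \<Longrightarrow> x \<in> K"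
    using C0_level[OF f] by blast
  have "x \<in> K" if "x \<in> topspace X" "\<epsilon> \<le> \<bar>g x\<bar>" for x
    using K(2)[OF that(1)] order_trans[OF that(2) le[of x]] \<open>0 < c\<close> by (simp add: field_simps)
  then show "\<exists>K. compactin X K \<and> (\<forall>x\<in>topspace X. \<epsilon> \<le> \<bar>g x\<bar> \<longrightarrow> x \<in> K)" using K(1) by blast
qed (use assms in auto)

lemma C0_add:
  assumes f: "f \<in> C0 X" and g: "g \<in> C0 X"
  shows "(\<lambda>x. f x + g x) \<in> C0 X"
proof (rule C0I)
  fix \<epsilon> :: real assume "0 < \<epsilon>"
  then have "\<epsilon> / 2 > 0" by simp
  from C0_level[OF f this] obtain K where
    K: "compactin X K" "\<And>x. x \<in> topspace X \<Longrightarrow> \<epsilon> / 2 \<le> \<bar>f x\<bar> \<Longrightarrow> x \<in> K" by blast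
  from C0_level[OF g \<open>\<epsilon> / 2 > 0\<close>] obtain L where
    L: "compactin X L" "\<And>x. x \<in> topspace X \<Longrightarrow> \<epsilon> / 2 \<le> \<bar>g x\<bar> \<Longrightarrow> x \<in> L" by blast
  have "x \<in> K \<union> L" if "x \<in> topspace X" "\<epsilon> \<le> \<bar>f x + g x\<bar>" for x
  proof -
    have "\<epsilon> / 2 \<le> \<bar>f x\<bar> \<or> \<epsilon> / 2 \<le> \<bar>g x\<bar>" using that(2) by linarith
    then show ?thesis using K(2) L(2) that(1) by blast
  qed
  then show "\<exists>K. compactin X K \<and> (\<forall>x\<in>topspace X. \<epsilon> \<le> \<bar>f x + g x\<bar> \<longrightarrow> x \<in> K)"
    using compactin_Un[OF K(1) L(1)] by blast
qed (use f g in \<open>simp_all add: C0_continuous C0_off continuous_map_add\<close>)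

text \<open>\<open>\<bar>c\<bar> + 1\<close> instead of \<open>\<bar>c\<bar>\<close> keeps the
  domination constant positive when \<open>c = 0\<close>.\<close>

lemma C0_cmult: "f \<in> C0 X \<Longrightarrow> (\<lambda>x. c * f x) \<in> C0 X"
  by (rule C0_dominated[where c = "\<bar>c\<bar> + 1"])
    (auto simp: C0_continuous C0_off abs_mult intro!: continuous_map_real_mult mult_right_mono)

lemma C0_diff: "f \<in> C0 X \<Longrightarrow> g \<in> C0 X \<Longrightarrow> (\<lambda>x. f x - g x) \<in> C0 X"
  using C0_add[of f X "\<lambda>x. - g x"] C0_cmult[of g X "-1"] by simp

lemma C0_minus: "f \<in> C0 X \<Longrightarrow> (\<lambda>x. - f x) \<in> C0 X"
  using C0_cmult[of f X "-1"] by simp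

lemma C0_abs: "f \<in> C0 X \<Longrightarrow> (\<lambda>x. \<bar>f x\<bar>) \<in> C0 X"
  by (rule C0_dominated[where c = 1]) (auto simp: C0_continuous C0_off intro!: continuous_map_real_abs)

lemma C0_pos_part: "f \<in> C0 X \<Longrightarrow> (\<lambda>x. max (f x) 0) \<in> C0 X"
  by (rule C0_dominated[where c = 1]) (auto simp: C0_continuous C0_off intro!: continuous_map_real_max)

lemma C0_max: "f \<in> C0 X \<Longrightarrow> g \<in> C0 X \<Longrightarrow> (\<lambda>x. max (f x) (g x)) \<in> C0 X"
proof -
  assume "f \<in> C0 X" "g \<in> C0 X"
  then have "(\<lambda>x. max (f x - g x) 0 + g x) \<in> C0 X"
    by (intro C0_add C0_pos_part C0_diff)
  also have "(\<lambda>x. max (f x - g x) 0 + g x) = (\<lambda>x. max (f x) (g x))"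
    by (auto simp: max_def)
  finally show ?thesis .
qed

lemma C0_min: "f \<in> C0 X \<Longrightarrow> g \<in> C0 X \<Longrightarrow> (\<lambda>x. min (f x) (g x)) \<in> C0 X"
  using C0_minus[OF C0_max[OF C0_minus C0_minus, of f X g]] by (simp add: minus_max_eq_min)

lemma C0_bounded:
  assumes f: "f \<in> C0 X"
  obtains N where "\<And>x. \<bar>f x\<bar> \<le> real N"
proof -
  let ?K = "{x \<in> topspace X. 1 \<le> \<bar>f x\<bar>}"
  have "compactin euclideanreal (f ` ?K)"
    using compactin_C0_level[OF f zero_less_one] C0_continuous[OF f] by (rule image_compactin)
  then have "bounded (f ` ?K)" by (simp add: compact_imp_bounded)
  then obtain B where B: "\<And>x. x \<in> ?K \<Longrightarrow> \<bar>f x\<bar> \<le> B"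
    unfolding bounded_iff real_norm_def by (elim exE) (rule that, blast)
  obtain N where "max B 1 \<le> real N" using real_arch_simple by blast
  then have "\<bar>f x\<bar> \<le> real N" for x
    using B[of x] C0_off[OF f, of x] \<open>max B 1 \<le> real N\<close> by (cases "x \<in> topspace X"; cases "1 \<le> \<bar>f x\<bar>") auto
  then show thesis by (rule that)
qed

section \<open>Cutoff functions on locally compact Hausdorff spaces\<close>

locale lch_space =
  fixes X :: "'x topology"
  assumes lc: "locally_compact_space X" and Hausdorff: "Hausdorff_space X"
begin

lemma compact_closed: "compactin X K \<Longrightarrow> closedin X K"
  by (rule compactin_imp_closedin[OF Hausdorff])

lemma supp_in_subset: "compactin X K \<Longrightarrow> {x \<in> topspace X. f x \<noteq> 0} \<subseteq> K \<Longrightarrow> supp_in X f \<subseteq> K"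
  unfolding supp_in_def by (rule closure_of_minimal) (auto intro: compact_closed)

lemma CcI:
  assumes "continuous_map X euclideanreal f" "\<And>x. x \<notin> topspace X \<Longrightarrow> f x = 0"
    and "compactin X K" "{x \<in> topspace X. f x \<noteq> 0} \<subseteq> K"
  shows "f \<in> Cc X"
proof -
  have "compactin X (supp_in X f)"
    using assms(3) supp_in_subset[OF assms(3,4)]
    by (rule closed_compactin) (simp add: supp_in_def closedin_closure_of)
  with assms show ?thesis by (simp add: Cc_def)
qed

lemma supp_in_superset: "(\<And>x. x \<notin> topspace X \<Longrightarrow> f x = 0) \<Longrightarrow> f x \<noteq> 0 \<Longrightarrow> x \<in> supp_in X f"
  unfolding supp_in_def by (rule subsetD[OF closure_of_subset]) auto

lemma Cc_imp_C0:
  assumes "f \<in> Cc X"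
  shows "f \<in> C0 X"
proof (rule C0I)
  fix \<epsilon> :: real assume "0 < \<epsilon>"
  then show "\<exists>K. compactin X K \<and> (\<forall>x\<in>topspace X. \<epsilon> \<le> \<bar>f x\<bar> \<longrightarrow> x \<in> K)"
    using assms supp_in_superset[of f] by (intro exI[of _ "supp_in X f"]) (auto simp: Cc_def)
qed (use assms in \<open>auto simp: Cc_def\<close>)

text \<open>Any compact carrier \<open>K\<close> of \<open>f\<close> can stand in for the support:
  compact sets are closed in a Hausdorff space, so the support lies in \<open>K\<close>.\<close>

lemma prec_setI:
  assumes "continuous_map X euclideanreal f" "\<And>x. x \<notin> topspace X \<Longrightarrow> f x = 0"
    and "\<And>x. 0 \<le> f x" "\<And>x. f x \<le> 1"
    and "compactin X K" "\<And>x. f x \<noteq> 0 \<Longrightarrow> x \<in> K" "K \<subseteq> V"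
  shows "prec_set X f V"
proof -
  have sub: "{x \<in> topspace X. f x \<noteq> 0} \<subseteq> K" using assms(6) by blast
  show ?thesis
    unfolding prec_set_def using assms CcI[OF assms(1,2,5) sub] supp_in_subset[OF assms(5) sub] by (simp add: subset_trans)
qed

lemma prec_setE:
  assumes "prec_set X f V"
  obtains K where "f \<in> C0 X" "continuous_map X euclideanreal f" "\<And>x. x \<notin> topspace X \<Longrightarrow> f x = 0"
    and "\<And>x. 0 \<le> f x" "\<And>x. f x \<le> 1" "compactin X K" "\<And>x. f x \<noteq> 0 \<Longrightarrow> x \<in> K" "K \<subseteq> V"
proof
  show "f \<in> C0 X" using assms Cc_imp_C0 by (simp add: prec_set_def)
  show off: "x \<notin> topspace X \<Longrightarrow> f x = 0" for x using assms by (simp add: prec_set_def Cc_def)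
  show "0 \<le> f x" "f x \<le> 1" for x
    using assms off[of x] by (cases "x \<in> topspace X"; simp add: prec_set_def)+
  show "f x \<noteq> 0 \<Longrightarrow> x \<in> supp_in X f" for x using supp_in_superset off by blast
qed (use assms in \<open>auto simp: prec_set_def Cc_def\<close>)

lemma prec_set_range: "prec_set X f V \<Longrightarrow> 0 \<le> f x \<and> f x \<le> 1"
  by (erule prec_setE) simp

lemma prec_set_off: "prec_set X f V \<Longrightarrow> x \<notin> V \<Longrightarrow> f x = 0"
  by (erule prec_setE) blast

lemma prec_set_C0: "prec_set X f V \<Longrightarrow> f \<in> C0 X"
  by (erule prec_setE)

text \<open>A separating function \<open>g\<close> that vanishes off an open set may have support
  reaching the boundary of that set. Keeping only the part of \<open>g\<close> above
  \<open>1 / 2\<close>, rescaled, puts the support inside a compact level set.\<close>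

lemma urysohn:
  assumes K: "compactin X K" and V: "openin X V" and "K \<subseteq> V"
  obtains f where "prec_set X f V" "set_prec X K f"
proof -
  obtain U L where U: "openin X U" "compactin X L" "closedin X L" "K \<subseteq> U" "U \<subseteq> L"
    using locally_compact_space_compact_closed_compact[of X] lc Hausdorff K by blast
  have "completely_regular_space X"
    using lc Hausdorff locally_compact_regular_imp_completely_regular_space by blast
  moreover have "closedin X (topspace X - U \<inter> V)" using U V by blast
  moreover have "disjnt K (topspace X - U \<inter> V)" using U \<open>K \<subseteq> V\<close> by (auto simp: disjnt_def)
  ultimately obtain g where g: "continuous_map X (top_of_set {0..1}) g"
    "g ` (topspace X - U \<inter> V) \<subseteq> {0}" "g ` K \<subseteq> {1::real}"
    using Urysohn_completely_regular_compact_closed[of 0 1 X K "topspace X - U \<inter> V"] K by auto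
  then have cg: "continuous_map X euclideanreal g" and g01: "\<And>x. x \<in> topspace X \<Longrightarrow> 0 \<le> g x \<and> g x \<le> 1"
    by (auto simp: continuous_map_in_subtopology Pi_iff image_subset_iff)
  define f where "f x = (if x \<in> topspace X then max (2 * g x - 1) 0 else 0)" for x
  have cf: "continuous_map X euclideanreal f"
    by (rule continuous_map_eq[of _ _ "\<lambda>x. max (2 * g x - 1) 0"])
      (use cg in \<open>auto simp: f_def intro!: continuous_intros\<close>)
  let ?K = "{x \<in> topspace X. 1 / 2 \<le> g x}"
  have sub: "?K \<subseteq> U \<inter> V" using g(2) by fastforce
  have K': "compactin X ?K"
    using U(2) _ closedin_level(1)[OF cg] by (rule closed_compactin) (use sub U in blast)
  have "prec_set X f V"
  proof (rule prec_setI[OF cf _ _ _ K'])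
    show "?K \<subseteq> V" using sub by blast
    show "f x \<noteq> 0 \<Longrightarrow> x \<in> ?K" for x by (auto simp: f_def split: if_splits)
  qed (use g01 in \<open>auto simp: f_def\<close>)
  moreover have "set_prec X K f"
    using \<open>prec_set X f V\<close> g(3) compactin_subset_topspace[OF K]
    by (auto simp: set_prec_def prec_set_def f_def)
  ultimately show thesis by (rule that)
qed

lemma prec_set_max:
  assumes "prec_set X f U" "prec_set X g V"
  shows "prec_set X (\<lambda>x. max (f x) (g x)) (U \<union> V)"
proof -
  from assms(1) obtain K where f: "continuous_map X euclideanreal f" "\<And>x. x \<notin> topspace X \<Longrightarrow> f x = 0"
    "\<And>x. 0 \<le> f x" "\<And>x. f x \<le> 1" "compactin X K" "\<And>x. f x \<noteq> 0 \<Longrightarrow> x \<in> K" "K \<subseteq> U"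
    by (rule prec_setE) blast
  from assms(2) obtain L where g: "continuous_map X euclideanreal g" "\<And>x. x \<notin> topspace X \<Longrightarrow> g x = 0"
    "\<And>x. 0 \<le> g x" "\<And>x. g x \<le> 1" "compactin X L" "\<And>x. g x \<noteq> 0 \<Longrightarrow> x \<in> L" "L \<subseteq> V"
    by (rule prec_setE) blast
  show ?thesis
  proof (rule prec_setI[where K = "K \<union> L"])
    show "x \<in> K \<union> L" if "max (f x) (g x) \<noteq> 0" for x
      using that f(6)[of x] g(6)[of x] by (auto simp: max_def split: if_splits)
  qed (use f g in \<open>auto intro: continuous_map_real_max compactin_Un le_max_iff_disj[THEN iffD2]\<close>)
qed

lemma prec_set_min:
  assumes "prec_set X f U" "prec_set X g V"
  shows "prec_set X (\<lambda>x. min (f x) (g x)) (U \<inter> V)"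
proof -
  from assms(1) obtain K where f: "continuous_map X euclideanreal f" "\<And>x. x \<notin> topspace X \<Longrightarrow> f x = 0"
    "\<And>x. 0 \<le> f x" "\<And>x. f x \<le> 1" "compactin X K" "\<And>x. f x \<noteq> 0 \<Longrightarrow> x \<in> K" "K \<subseteq> U"
    by (rule prec_setE) blast
  from assms(2) obtain L where g: "continuous_map X euclideanreal g" "\<And>x. x \<notin> topspace X \<Longrightarrow> g x = 0"
    "\<And>x. 0 \<le> g x" "\<And>x. g x \<le> 1" "compactin X L" "\<And>x. g x \<noteq> 0 \<Longrightarrow> x \<in> L" "L \<subseteq> V"
    by (rule prec_setE) blast
  show ?thesis
  proof (rule prec_setI[where K = "K \<inter> L"])
    show "compactin X (K \<inter> L)" using f(5) g(5) compact_closed by (simp add: compact_Int_closedin)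
    show "x \<in> K \<inter> L" if "min (f x) (g x) \<noteq> 0" for x
      using that f(3)[of x] g(3)[of x] f(6)[of x] g(6)[of x] by (auto simp: min_def split: if_splits)
  qed (use f g in \<open>auto intro: continuous_map_real_min min.coboundedI1\<close>)
qed

text \<open>Disjointness turns the sum into a maximum, which keeps it below one.\<close>

lemma prec_set_add_disjoint:
  assumes "prec_set X f U" "prec_set X g V" "U \<inter> V = {}"
  shows "prec_set X (\<lambda>x. f x + g x) (U \<union> V)"
proof -
  have "f x + g x = max (f x) (g x)" for x
    using prec_set_range[OF assms(1), of x] prec_set_range[OF assms(2), of x]
      prec_set_off[OF assms(1), of x] prec_set_off[OF assms(2), of x] assms(3)
    by (smt (verit) IntI empty_iff)
  then have "(\<lambda>x. f x + g x) = (\<lambda>x. max (f x) (g x))" by (rule ext)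
  then show ?thesis using prec_set_max[OF assms(1,2)] by simp
qed

lemma prec_set_zero: "prec_set X (\<lambda>x. 0) V"
  by (rule prec_setI[of _ "{}"]) auto

lemma prec_set_mono: "prec_set X f U \<Longrightarrow> U \<subseteq> V \<Longrightarrow> prec_set X f V"
  by (auto simp: prec_set_def)

end

text \<open>Continuity comes from the uniform limit theorem along approximants with error
  \<open>1 / (n + 1)\<close>; decay at infinity needs a single approximant with error
  \<open>\<epsilon> / 2\<close>.\<close>

lemma C0_uniform_limit:
  assumes "\<And>\<epsilon>. \<epsilon> > 0 \<Longrightarrow> \<exists>g\<in>C0 X. \<forall>x. \<bar>f x - g x\<bar> \<le> \<epsilon>" and off: "\<And>x. x \<notin> topspace X \<Longrightarrow> f x = 0"
  shows "f \<in> C0 X"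
proof (rule C0I)
  have "\<exists>g\<in>C0 X. \<forall>x. \<bar>f x - g x\<bar> \<le> 1 / real (Suc n)" for n
    using assms(1)[of "1 / real (Suc n)"] by simp
  then obtain g where g: "\<And>n. g n \<in> C0 X" "\<And>n x. \<bar>f x - g n x\<bar> \<le> 1 / real (Suc n)" by metis
  have "continuous_map X Met_TC.mtopology f"
  proof (rule Met_TC.continuous_map_uniform_limit[where F = sequentially and f = g])
    show "\<forall>\<^sub>F n in sequentially. continuous_map X Met_TC.mtopology (g n)"
      using g(1) by (intro always_eventually) (simp add: C0_continuous mtopology_is_euclidean)
    fix \<epsilon> :: real assume "0 < \<epsilon>"
    then have "\<forall>\<^sub>F n in sequentially. 1 / real (Suc n) < \<epsilon>"
      using LIMSEQ_inverse_real_of_nat by (simp add: order_tendstoD(2) inverse_eq_divide del: of_nat_Suc)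
    then show "\<forall>\<^sub>F n in sequentially. \<forall>x\<in>topspace X. f x \<in> UNIV \<and> dist (g n x) (f x) < \<epsilon>"
      by eventually_elim (use g(2) in \<open>auto simp: dist_real_def abs_minus_commute simp del: of_nat_Suc intro: le_less_trans\<close>)
  qed simp
  then show "continuous_map X euclideanreal f" by (simp add: mtopology_is_euclidean)
next
  fix \<epsilon> :: real assume "0 < \<epsilon>"
  then have "\<epsilon> / 2 > 0" by simp
  then obtain g where g: "g \<in> C0 X" "\<And>x. \<bar>f x - g x\<bar> \<le> \<epsilon> / 2" using assms(1) by blast
  then obtain K where K: "compactin X K" "\<And>x. x \<in> topspace X \<Longrightarrow> \<epsilon> / 2 \<le> \<bar>g x\<bar> \<Longrightarrow> x \<in> K"
    using C0_level[OF g(1) \<open>\<epsilon> / 2 > 0\<close>] by blast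
  have "x \<in> K" if "x \<in> topspace X" "\<epsilon> \<le> \<bar>f x\<bar>" for x
  proof (rule K(2)[OF that(1)])
    show "\<epsilon> / 2 \<le> \<bar>g x\<bar>" using that(2) g(2)[of x] by linarith
  qed
  then show "\<exists>K. compactin X K \<and> (\<forall>x\<in>topspace X. \<epsilon> \<le> \<bar>f x\<bar> \<longrightarrow> x \<in> K)" using K(1) by blast
qed (rule off)

text \<open>\<open>F\<close> is the sum of the \<open>f n / 2 ^ n\<close>, a uniform limit since the
  tails are at most \<open>2 * (1 / 2) ^ k\<close>. One function thus dominates every
  \<open>f n\<close> up to a factor, which is what refutes unboundedness of a positive
  operator.\<close>

lemma C0_geometric_series:
  assumes f: "\<And>n. f n \<in> C0 X" "\<And>n x. 0 \<le> f n x" "\<And>n x. f n x \<le> 1"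
  obtains F where "F \<in> C0 X" "\<And>n x. f n x \<le> 2 ^ n * F x"
proof -
  define a where "a x n = (1 / 2) ^ n * f n x" for x n
  have a: "0 \<le> a x n" "a x n \<le> (1 / 2) ^ n" for x n
    using f(2,3)[of n x] by (auto simp: a_def intro: mult_left_le)
  have geo: "summable (\<lambda>n. (1 / 2 :: real) ^ n)" by (rule summable_geometric) simp
  have sum: "summable (a x)" for x
    by (rule summable_comparison_test'[OF geo, of 0]) (use a in simp)
  define F where "F x = (\<Sum>n. a x n)" for x
  have part: "(\<lambda>x. \<Sum>n<k. a x n) \<in> C0 X" for k
  proof (induction k)
    case 0
    then show ?case using C0_cmult[OF f(1)[of 0], of 0] by (simp only: mult_zero_left lessThan_0 sum.empty)
  next
    case (Suc k)
    then show ?case unfolding sum.lessThan_Suc a_def by (intro C0_add C0_cmult f(1))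
  qed
  have tail: "\<bar>F x - (\<Sum>n<k. a x n)\<bar> \<le> 2 * (1 / 2) ^ k" for x k
  proof -
    have sk: "summable (\<lambda>n. a x (n + k))" using sum by (rule summable_ignore_initial_segment)
    have "F x - (\<Sum>n<k. a x n) = (\<Sum>n. a x (n + k))"
      using suminf_split_initial_segment[OF sum[of x], of k] by (simp add: F_def)
    moreover have "0 \<le> (\<Sum>n. a x (n + k))" using a sk by (intro suminf_nonneg) auto
    moreover have "(\<Sum>n. a x (n + k)) \<le> (\<Sum>n. (1 / 2) ^ k * (1 / 2) ^ n)"
    proof (rule suminf_le)
      show "a x (n + k) \<le> (1 / 2) ^ k * (1 / 2) ^ n" for n
        using a(2)[of x "n + k"] by (simp add: power_add mult.commute)
    qed (use sk geo summable_mult in blast)+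
    moreover have "(\<Sum>n. (1 / 2) ^ k * (1 / 2) ^ n) = 2 * (1 / 2 :: real) ^ k"
      using geo suminf_geometric[of "1 / 2 :: real"] by (subst suminf_mult) simp_all
    ultimately show ?thesis by simp
  qed
  have "F \<in> C0 X"
  proof (rule C0_uniform_limit)
    fix \<epsilon> :: real assume "0 < \<epsilon>"
    then obtain k where "(1 / 2) ^ k < \<epsilon> / 2" using real_arch_pow_inv[of "\<epsilon> / 2" "1 / 2"] by auto
    then have "\<bar>F x - (\<Sum>n<k. a x n)\<bar> \<le> \<epsilon>" for x using tail[of x k] by linarith
    then show "\<exists>g\<in>C0 X. \<forall>x. \<bar>F x - g x\<bar> \<le> \<epsilon>" by (intro bexI[OF _ part[of k]]) simp
  next
    fix x assume "x \<notin> topspace X"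
    then have "a x n = 0" for n using C0_off[OF f(1)] by (simp add: a_def)
    then show "F x = 0" by (simp add: F_def)
  qed
  moreover have "f n x \<le> 2 ^ n * F x" for n x
  proof -
    have "a x n \<le> F x"
      unfolding F_def using sum_le_suminf[OF sum[of x], of "{n}"] a(1) by simp
    then show ?thesis by (simp add: a_def power_one_over field_simps)
  qed
  ultimately show thesis by (rule that)
qed

subsection \<open>The set function on open sets\<close>

locale riesz = lch_space X for X :: "'x topology" +
  fixes \<pi> :: "('x \<Rightarrow> real) \<Rightarrow> 'e::kb_space"
  assumes pos: "positive_operator (C0 X) \<pi>"
begin

lemma pi_add: "f \<in> C0 X \<Longrightarrow> g \<in> C0 X \<Longrightarrow> \<pi> (\<lambda>x. f x + g x) = \<pi> f + \<pi> g"
  using pos by (simp add: positive_operator_def)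

lemma pi_cmult: "f \<in> C0 X \<Longrightarrow> \<pi> (\<lambda>x. c * f x) = c *\<^sub>R \<pi> f"
  using pos by (simp add: positive_operator_def)

lemma pi_nonneg: "f \<in> C0 X \<Longrightarrow> (\<And>x. 0 \<le> f x) \<Longrightarrow> 0 \<le> \<pi> f"
  using pos by (simp add: positive_operator_def)

lemma pi_mono:
  assumes "f \<in> C0 X" "g \<in> C0 X" "\<And>x. f x \<le> g x"
  shows "\<pi> f \<le> \<pi> g"
  using pi_add[OF assms(1) C0_diff[OF assms(2,1)]] pi_nonneg[OF C0_diff[OF assms(2,1)]] assms(3) by simp

lemma zero_C0: "(\<lambda>x. 0) \<in> C0 X"
  using prec_set_zero by (rule prec_set_C0)

lemma pi_zero: "\<pi> (\<lambda>x. 0) = 0"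
  using pi_cmult[OF zero_C0, of 0] by simp

lemma pi_diff: "f \<in> C0 X \<Longrightarrow> g \<in> C0 X \<Longrightarrow> \<pi> (\<lambda>x. f x - g x) = \<pi> f - \<pi> g"
  using pi_add[OF C0_diff, of f g g] by simp

lemma C0_sum: "finite I \<Longrightarrow> (\<And>i. i \<in> I \<Longrightarrow> f i \<in> C0 X) \<Longrightarrow> (\<lambda>x. \<Sum>i\<in>I. f i x) \<in> C0 X"
  by (induction I rule: finite_induct) (simp_all add: zero_C0 C0_add)

lemma pi_sum:
  "finite I \<Longrightarrow> (\<And>i. i \<in> I \<Longrightarrow> f i \<in> C0 X) \<Longrightarrow> \<pi> (\<lambda>x. \<Sum>i\<in>I. f i x) = (\<Sum>i\<in>I. \<pi> (f i))"
  by (induction I rule: finite_induct) (simp_all add: pi_zero pi_add C0_sum)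

text \<open>
  If \<open>norm (\<pi> (f n)) > 4 ^ n\<close> for all \<open>n\<close>, then \<open>\<pi> F\<close> with \<open>F = (\<Sum>n. f n / 2 ^ n)\<close> has norm larger
  than every \<open>2 ^ n\<close>.
\<close>

lemma pi_bounded: "\<exists>B. \<forall>f\<in>C0 X. (\<forall>x. 0 \<le> f x \<and> f x \<le> 1) \<longrightarrow> norm (\<pi> f) \<le> B"
proof (rule ccontr)
  assume "\<nexists>B. \<forall>f\<in>C0 X. (\<forall>x. 0 \<le> f x \<and> f x \<le> 1) \<longrightarrow> norm (\<pi> f) \<le> B"
  then have "\<exists>f\<in>C0 X. (\<forall>x. 0 \<le> f x \<and> f x \<le> 1) \<and> 4 ^ n < norm (\<pi> f)" for n :: nat
    by (meson not_less)
  then obtain f where f: "\<And>n. f n \<in> C0 X" "\<And>n x. 0 \<le> f n x" "\<And>n x. f n x \<le> 1"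
    "\<And>n. 4 ^ n < norm (\<pi> (f n))" by metis
  then obtain F where F: "F \<in> C0 X" "\<And>n x. f n x \<le> 2 ^ n * F x"
    using C0_geometric_series[of f X] by blast
  have "2 ^ n < norm (\<pi> F)" for n
  proof -
    have "\<pi> (f n) \<le> 2 ^ n *\<^sub>R \<pi> F"
      using pi_mono[OF f(1) C0_cmult[OF F(1)] F(2), of n] F(1) by (simp add: pi_cmult)
    then have "norm (\<pi> (f n)) \<le> 2 ^ n * norm (\<pi> F)"
      using norm_mono[OF pi_nonneg[OF f(1,2)], of n] by fastforce
    then have "2 ^ n * 2 ^ n < 2 ^ n * norm (\<pi> F)"
      using f(4)[of n] by (simp flip: power_mult_distrib)
    then show ?thesis by simp
  qed
  moreover obtain n where "norm (\<pi> F) < 2 ^ n" using real_arch_pow[of 2] by auto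
  ultimately show False by (meson less_asym)
qed

definition \<mu>_open :: "'x set \<Rightarrow> 'e" where
  "\<mu>_open V = (THE a. isLub UNIV {\<pi> f | f. prec_set X f V} a)"

text \<open>Pointwise maxima make the family directed and \<open>pi_bounded\<close> makes it norm
  bounded, so the supremum exists in \<open>E\<close> and is a norm limit.\<close>

lemma \<mu>_open_lub: "isLub UNIV {\<pi> f | f. prec_set X f V} (\<mu>_open V)" (is ?lub)
  and \<mu>_open_approx: "\<epsilon> > 0 \<Longrightarrow> \<exists>f. prec_set X f V \<and> norm (\<mu>_open V - \<pi> f) < \<epsilon>"
proof -
  let ?S = "{\<pi> f | f. prec_set X f V}"
  obtain B where B: "\<forall>f\<in>C0 X. (\<forall>x. 0 \<le> f x \<and> f x \<le> 1) \<longrightarrow> norm (\<pi> f) \<le> B"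
    using pi_bounded by (elim exE)
  obtain l where l: "isLub UNIV ?S l" "\<And>\<epsilon>. \<epsilon> > 0 \<Longrightarrow> \<exists>x\<in>?S. norm (l - x) < \<epsilon>"
  proof (rule kb_directed_lub[of ?S B])
    show "?S \<noteq> {}" using prec_set_zero by blast
    fix x assume "x \<in> ?S"
    then obtain f where f: "x = \<pi> f" "prec_set X f V" by blast
    then show "0 \<le> x" "norm x \<le> B"
      using B prec_set_C0[OF f(2)] prec_set_range[OF f(2)] by (simp_all add: pi_nonneg)
  next
    fix x y assume "x \<in> ?S" "y \<in> ?S"
    then obtain f g where fg: "x = \<pi> f" "y = \<pi> g" "prec_set X f V" "prec_set X g V" by blast
    then have m: "prec_set X (\<lambda>x. max (f x) (g x)) V" using prec_set_max[of f V g V] by simp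
    then have "\<pi> f \<le> \<pi> (\<lambda>x. max (f x) (g x))" "\<pi> g \<le> \<pi> (\<lambda>x. max (f x) (g x))"
      using fg by (auto intro!: pi_mono prec_set_C0)
    then show "\<exists>z\<in>?S. x \<le> z \<and> y \<le> z" using m fg(1,2) by blast
  qed (rule that)
  have "\<mu>_open V = l"
    unfolding \<mu>_open_def using l(1) isLub_UNIV_unique by (intro the_equality) blast+
  then show ?lub "\<epsilon> > 0 \<Longrightarrow> \<exists>f. prec_set X f V \<and> norm (\<mu>_open V - \<pi> f) < \<epsilon>"
    using l by blast+
qed

lemma pi_le_\<mu>_open: "prec_set X f V \<Longrightarrow> \<pi> f \<le> \<mu>_open V"
  using \<mu>_open_lub[of V] by (auto simp: isLub_UNIV_iff)

lemma \<mu>_open_least: "(\<And>f. prec_set X f V \<Longrightarrow> \<pi> f \<le> b) \<Longrightarrow> \<mu>_open V \<le> b"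
  using \<mu>_open_lub[of V] unfolding isLub_UNIV_iff by blast

lemma \<mu>_open_nonneg: "0 \<le> \<mu>_open V"
  using pi_le_\<mu>_open[OF prec_set_zero] by (simp add: pi_zero)

lemma \<mu>_open_mono: "U \<subseteq> V \<Longrightarrow> \<mu>_open U \<le> \<mu>_open V"
  using prec_set_mono pi_le_\<mu>_open by (blast intro: \<mu>_open_least)

lemma \<mu>_open_empty: "\<mu>_open {} = 0"
proof (rule antisym)
  show "\<mu>_open {} \<le> 0"
  proof (rule \<mu>_open_least)
    fix f assume "prec_set X f {}"
    then have "f = (\<lambda>x. 0)" using prec_set_off by blast
    then show "\<pi> f \<le> 0" by (simp add: pi_zero)
  qed
qed (rule \<mu>_open_nonneg)

text \<open>The carrier of \<open>h\<close> is a union of compact sets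
  \<open>K1 \<subseteq> U\<close> and \<open>K2 \<subseteq> V\<close>; Urysohn functions equal to
  one on these sets add up to at least \<open>h\<close>.\<close>

lemma \<mu>_open_subadd:
  assumes U: "openin X U" and V: "openin X V"
  shows "\<mu>_open (U \<union> V) \<le> \<mu>_open U + \<mu>_open V"
proof (rule \<mu>_open_least)
  fix h assume h: "prec_set X h (U \<union> V)"
  from h obtain K where K: "compactin X K" "\<And>x. h x \<noteq> 0 \<Longrightarrow> x \<in> K" "K \<subseteq> U \<union> V"
    by (rule prec_setE) blast
  have KV: "compactin X (K - V)"
    using K(1) compact_closed[OF K(1)] V by (intro closed_compactin[OF K(1)]) auto
  \<comment> \<open>\<open>f\<close> decides the splitting: it is zero off \<open>U\<close> and one
    on \<open>K - V\<close>, so the part of \<open>K\<close> with \<open>f \<ge> 1 / 2\<close> lies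
    in \<open>U\<close> and the part with \<open>f \<le> 1 / 2\<close> lies in
    \<open>V\<close>.\<close>
  obtain f where f: "prec_set X f U" "set_prec X (K - V) f"
    using urysohn[OF KV U] K(3) by blast
  then have cf: "continuous_map X euclideanreal f" by (simp add: prec_set_def Cc_def)
  have top: "K \<subseteq> topspace X" using K(1) by (rule compactin_subset_topspace)
  define K1 where "K1 = K \<inter> {x \<in> topspace X. 1 / 2 \<le> f x}"
  define K2 where "K2 = K \<inter> {x \<in> topspace X. f x \<le> 1 / 2}"
  have c: "compactin X K1" "compactin X K2"
    unfolding K1_def K2_def using compact_Int_closedin[OF K(1)] closedin_level[OF cf] by blast+
  have "K1 \<subseteq> U" unfolding K1_def using prec_set_off[OF f(1)] by fastforce
  then obtain f1 where f1: "prec_set X f1 U" "set_prec X K1 f1" using urysohn[OF c(1) U] by blast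
  have "K2 \<subseteq> V" unfolding K2_def using f(2) by (force simp: set_prec_def)
  then obtain f2 where f2: "prec_set X f2 V" "set_prec X K2 f2" using urysohn[OF c(2) V] by blast
  have "h x \<le> f1 x + f2 x" for x
  proof (cases "x \<in> K")
    case True
    then have "x \<in> K1 \<or> x \<in> K2" using top by (auto simp: K1_def K2_def)
    then have "f1 x = 1 \<or> f2 x = 1" using f1(2) f2(2) by (auto simp: set_prec_def)
    then show ?thesis
      using prec_set_range[OF h, of x] prec_set_range[OF f1(1), of x] prec_set_range[OF f2(1), of x] by auto
  next
    case False
    then have "h x = 0" using K(2) by blast
    then show ?thesis using prec_set_range[OF f1(1), of x] prec_set_range[OF f2(1), of x] by auto
  qed
  then have "\<pi> h \<le> \<pi> (\<lambda>x. f1 x + f2 x)"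
    using h f1 f2 by (intro pi_mono C0_add prec_set_C0)
  also have "\<dots> = \<pi> f1 + \<pi> f2" using f1 f2 by (intro pi_add prec_set_C0)
  also have "\<dots> \<le> \<mu>_open U + \<mu>_open V" using f1 f2 by (intro add_mono pi_le_\<mu>_open)
  finally show "\<pi> h \<le> \<mu>_open U + \<mu>_open V" .
qed

lemma \<mu>_open_supermodular: "\<mu>_open U + \<mu>_open V \<le> \<mu>_open (U \<union> V) + \<mu>_open (U \<inter> V)"
proof -
  let ?c = "\<mu>_open (U \<union> V) + \<mu>_open (U \<inter> V)"
  have le: "\<pi> f + \<pi> g \<le> ?c" if f: "prec_set X f U" and g: "prec_set X g V" for f g
  proof -
    have "\<pi> f + \<pi> g = \<pi> (\<lambda>x. max (f x) (g x) + min (f x) (g x))"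
      using pi_add[of f g] f g prec_set_C0 by (simp add: max_def min_def if_distrib add.commute cong: if_cong)
    also have "\<dots> = \<pi> (\<lambda>x. max (f x) (g x)) + \<pi> (\<lambda>x. min (f x) (g x))"
      using f g by (intro pi_add C0_max C0_min prec_set_C0)
    also have "\<dots> \<le> ?c" using f g by (intro add_mono pi_le_\<mu>_open prec_set_max prec_set_min)
    finally show ?thesis .
  qed
  \<comment> \<open>The two suprema are taken one after the other, with the other term moved to the
    right-hand side.\<close>
  have "\<mu>_open U \<le> ?c - \<pi> g" if "prec_set X g V" for g
    using le that by (intro \<mu>_open_least) (simp add: le_diff_eq)
  then have "\<mu>_open V \<le> ?c - \<mu>_open U"
    by (intro \<mu>_open_least) (metis add.commute le_diff_eq)
  then show ?thesis by (simp add: le_diff_eq add.commute)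
qed

text \<open>Take \<open>K\<close> to be the compact carrier of a nearly optimal \<open>f\<close>. A
  function \<open>g\<close> carried by \<open>V - K\<close> can be added to \<open>f\<close> and the
  sum still competes for \<open>V\<close>, so \<open>\<pi> g\<close> is at most the gap left by
  \<open>f\<close>.\<close>

lemma \<mu>_open_compact_approx:
  assumes V: "openin X V" and "\<epsilon> > 0"
  obtains K where "compactin X K" "K \<subseteq> V" "norm (\<mu>_open (V - K)) < \<epsilon>"
proof -
  obtain f where f: "prec_set X f V" "norm (\<mu>_open V - \<pi> f) < \<epsilon>"
    using \<mu>_open_approx[OF \<open>\<epsilon> > 0\<close>] by blast
  from f(1) obtain K where K: "continuous_map X euclideanreal f" "\<And>x. x \<notin> topspace X \<Longrightarrow> f x = 0"
    "compactin X K" "\<And>x. f x \<noteq> 0 \<Longrightarrow> x \<in> K" "K \<subseteq> V"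
    by (rule prec_setE) blast
  have fK: "prec_set X f K"
    using K prec_set_range[OF f(1)] by (intro prec_setI[of f K K]) auto
  have "\<mu>_open (V - K) \<le> \<mu>_open V - \<pi> f"
  proof (rule \<mu>_open_least)
    fix g assume g: "prec_set X g (V - K)"
    have "prec_set X (\<lambda>x. f x + g x) V"
      using prec_set_add_disjoint[OF fK g] prec_set_mono[of "\<lambda>x. f x + g x" "K \<union> (V - K)" V] K(5) by blast
    then have "\<pi> (\<lambda>x. f x + g x) \<le> \<mu>_open V" by (rule pi_le_\<mu>_open)
    also have "\<pi> (\<lambda>x. f x + g x) = \<pi> f + \<pi> g" using f(1) g by (intro pi_add prec_set_C0)
    finally show "\<pi> g \<le> \<mu>_open V - \<pi> f" by (simp add: le_diff_eq add.commute)
  qed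
  then have "norm (\<mu>_open (V - K)) \<le> norm (\<mu>_open V - \<pi> f)"
    by (intro norm_mono \<mu>_open_nonneg)
  then show thesis using that[of K] K f(2) by simp
qed

end

section \<open>The Borel \<sigma>-algebra of a topology\<close>

lemma space_borel_of: "space (borel_of X) = topspace X"
  and sets_borel_of: "sets (borel_of X) = sigma_sets (topspace X) {U. openin X U}"
proof -
  have "{U. openin X U} \<subseteq> Pow (topspace X)" using openin_subset by blast
  then show "space (borel_of X) = topspace X"
    "sets (borel_of X) = sigma_sets (topspace X) {U. openin X U}"
    by (simp_all add: borel_of_def space_measure_of sets_measure_of)
qed

lemma openin_borel_of: "openin X U \<Longrightarrow> U \<in> sets (borel_of X)"
  by (simp add: sets_borel_of)

lemma closedin_borel_of:
  assumes "closedin X C"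
  shows "C \<in> sets (borel_of X)"
proof -
  have "topspace X - C \<in> sets (borel_of X)" using assms by (intro openin_borel_of) blast
  then have "space (borel_of X) - (topspace X - C) \<in> sets (borel_of X)" by (rule sets.compl_sets)
  then show ?thesis using closedin_subset[OF assms] by (simp add: space_borel_of double_diff)
qed

lemma sets_borel_of_subset: "A \<in> sets (borel_of X) \<Longrightarrow> A \<subseteq> topspace X"
  using sets.sets_into_space[of A "borel_of X"] by (simp add: space_borel_of)

lemma borel_measurable_borel_of:
  assumes "continuous_map X euclideanreal f"
  shows "f \<in> borel_measurable (borel_of X)"
proof (rule borel_measurableI)
  fix S :: "real set" assume "open S"
  then have "openin X {x \<in> topspace X. f x \<in> S}"
    using openin_continuous_map_preimage[OF assms, of S] by simp
  moreover have "f -` S \<inter> space (borel_of X) = {x \<in> topspace X. f x \<in> S}"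
    by (auto simp: space_borel_of)
  ultimately show "f -` S \<inter> space (borel_of X) \<in> sets (borel_of X)" by (simp add: openin_borel_of)
qed

context riesz
begin

subsection \<open>Extension to Borel sets\<close>

definition \<mu>_outer :: "'x set \<Rightarrow> 'e" where
  "\<mu>_outer A = (THE a. isGlb UNIV {\<mu>_open V | V. openin X V \<and> A \<subseteq> V} a)"

text \<open>The KB property concerns increasing families, so the infimum is obtained from the
  supremum of the complementary values \<open>?T - \<mu>_open V\<close>. Intersecting two open
  neighbourhoods shows that these are directed.\<close>

lemma \<mu>_outer_glb:
  assumes A: "A \<subseteq> topspace X"
  shows "isGlb UNIV {\<mu>_open V | V. openin X V \<and> A \<subseteq> V} (\<mu>_outer A)"
proof -
  let ?T = "\<mu>_open (topspace X)"
  let ?S = "{?T - \<mu>_open V | V. openin X V \<and> A \<subseteq> V}"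
  have "?S \<noteq> {}" using A by blast
  obtain l where l: "isLub UNIV ?S l"
  proof (rule kb_directed_lub[of ?S "norm ?T"])
    show "?S \<noteq> {}" by fact
    fix x assume "x \<in> ?S"
    then obtain V where V: "x = ?T - \<mu>_open V" "openin X V" by blast
    then show "0 \<le> x" using \<mu>_open_mono[OF openin_subset[OF V(2)]] by simp
    then show "norm x \<le> norm ?T" using V(1) \<mu>_open_nonneg[of V] by (intro norm_mono) simp_all
  next
    fix x y assume "x \<in> ?S" "y \<in> ?S"
    then obtain U V where UV: "x = ?T - \<mu>_open U" "y = ?T - \<mu>_open V"
      "openin X U" "A \<subseteq> U" "openin X V" "A \<subseteq> V" by blast
    then have "?T - \<mu>_open (U \<inter> V) \<in> ?S" by blast
    moreover have "x \<le> ?T - \<mu>_open (U \<inter> V)" "y \<le> ?T - \<mu>_open (U \<inter> V)"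
      unfolding UV(1,2) by (intro diff_left_mono \<mu>_open_mono, blast)+
    ultimately show "\<exists>z\<in>?S. x \<le> z \<and> y \<le> z" by blast
  qed (rule that)
  have "isGlb UNIV {\<mu>_open V | V. openin X V \<and> A \<subseteq> V} (?T - l)"
    unfolding isGlb_UNIV_iff
  proof (intro conjI ballI allI impI)
    fix x assume "x \<in> {\<mu>_open V | V. openin X V \<and> A \<subseteq> V}"
    then have "?T - x \<in> ?S" by blast
    then have "?T - x \<le> l" using l by (simp only: isLub_UNIV_iff)
    then show "?T - l \<le> x" by (simp add: algebra_simps)
  next
    fix b assume b: "\<forall>x\<in>{\<mu>_open V | V. openin X V \<and> A \<subseteq> V}. b \<le> x"
    have "x \<le> ?T - b" if x: "x \<in> ?S" for x
    proof -
      obtain V where "x = ?T - \<mu>_open V" "openin X V" "A \<subseteq> V" using x by blast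
      moreover from this have "b \<le> \<mu>_open V" using b by blast
      ultimately show ?thesis by (simp add: diff_left_mono)
    qed
    then have "l \<le> ?T - b" using l unfolding isLub_UNIV_iff by blast
    then show "b \<le> ?T - l" by (simp add: algebra_simps)
  qed
  moreover from this have "\<mu>_outer A = ?T - l"
    unfolding \<mu>_outer_def using isGlb_UNIV_unique by (intro the_equality) blast+
  ultimately show ?thesis by simp
qed

lemma \<mu>_outer_le: "openin X V \<Longrightarrow> A \<subseteq> V \<Longrightarrow> \<mu>_outer A \<le> \<mu>_open V"
  using \<mu>_outer_glb[of A] openin_subset[of X V] by (auto simp: isGlb_UNIV_iff)

lemma \<mu>_outer_greatest:
  assumes "A \<subseteq> topspace X" "\<And>V. openin X V \<Longrightarrow> A \<subseteq> V \<Longrightarrow> b \<le> \<mu>_open V"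
  shows "b \<le> \<mu>_outer A"
  using \<mu>_outer_glb[OF assms(1)] assms(2) unfolding isGlb_UNIV_iff by blast

lemma \<mu>_outer_open: "openin X V \<Longrightarrow> \<mu>_outer V = \<mu>_open V"
  by (intro antisym \<mu>_outer_le \<mu>_outer_greatest) (simp_all add: \<mu>_open_mono openin_subset)

lemma \<mu>_outer_mono: "A \<subseteq> B \<Longrightarrow> B \<subseteq> topspace X \<Longrightarrow> \<mu>_outer A \<le> \<mu>_outer B"
  by (intro \<mu>_outer_greatest \<mu>_outer_le) auto

lemma \<mu>_outer_nonneg: "A \<subseteq> topspace X \<Longrightarrow> 0 \<le> \<mu>_outer A"
  by (intro \<mu>_outer_greatest \<mu>_open_nonneg)

text \<open>Any open \<open>W \<supseteq> A\<close> contains \<open>F\<close>, so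
  \<open>V \<subseteq> W \<union> (V - F)\<close> and subadditivity applies. This supplies the lower
  bounds for \<open>\<mu>_outer\<close>.\<close>

lemma \<mu>_open_le_outer:
  assumes "closedin X F" "openin X V" "F \<subseteq> A" "A \<subseteq> topspace X"
  shows "\<mu>_open V \<le> \<mu>_outer A + \<mu>_open (V - F)"
proof -
  have "\<mu>_open V - \<mu>_open (V - F) \<le> \<mu>_outer A"
  proof (rule \<mu>_outer_greatest[OF assms(4)])
    fix W assume W: "openin X W" "A \<subseteq> W"
    have "\<mu>_open V \<le> \<mu>_open (W \<union> (V - F))" using assms(3) W(2) by (intro \<mu>_open_mono) blast
    also have "\<dots> \<le> \<mu>_open W + \<mu>_open (V - F)"
      using W(1) assms(1,2) by (intro \<mu>_open_subadd) auto
    finally show "\<mu>_open V - \<mu>_open (V - F) \<le> \<mu>_open W" by (simp add: diff_le_eq)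
  qed
  then show ?thesis by (simp add: diff_le_eq)
qed

lemma \<mu>_open_UN_le:
  fixes W :: "nat \<Rightarrow> 'x set"
  assumes "\<And>i. openin X (W i)"
  shows "norm (\<mu>_open (\<Union>i<N. W i)) \<le> (\<Sum>i<N. norm (\<mu>_open (W i)))"
proof (induction N)
  case (Suc N)
  have "\<mu>_open (\<Union>i<Suc N. W i) \<le> \<mu>_open (W N) + \<mu>_open (\<Union>i<N. W i)"
    using assms unfolding lessThan_Suc UN_insert by (intro \<mu>_open_subadd) auto
  then have "norm (\<mu>_open (\<Union>i<Suc N. W i)) \<le> norm (\<mu>_open (W N) + \<mu>_open (\<Union>i<N. W i))"
    by (intro norm_mono \<mu>_open_nonneg)
  also have "\<dots> \<le> norm (\<mu>_open (W N)) + norm (\<mu>_open (\<Union>i<N. W i))" by (rule norm_triangle_ineq)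
  finally show ?case using Suc by simp
qed (simp add: \<mu>_open_empty)

text \<open>\<open>F\<close> is required to be closed rather than compact, which makes the condition
  symmetric under complements. The gap \<open>V - F\<close> is open, so \<open>\<mu>_open\<close>
  itself measures the error.\<close>

definition sandwiched :: "'x set \<Rightarrow> bool" where
  "sandwiched A \<longleftrightarrow> (\<forall>\<epsilon>>0. \<exists>F V. closedin X F \<and> openin X V \<and> F \<subseteq> A \<and> A \<subseteq> V \<and> norm (\<mu>_open (V - F)) < \<epsilon>)"

lemma sandwichedE:
  assumes "sandwiched A" "\<epsilon> > 0"
  obtains F V where "closedin X F" "openin X V" "F \<subseteq> A" "A \<subseteq> V" "norm (\<mu>_open (V - F)) < \<epsilon>"
  using assms(1)[unfolded sandwiched_def, rule_format, OF assms(2)] that by blast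

lemma sandwiched_open:
  assumes V: "openin X V"
  shows "sandwiched V"
  unfolding sandwiched_def
proof (intro allI impI)
  fix \<epsilon> :: real assume "0 < \<epsilon>"
  obtain K where "compactin X K" "K \<subseteq> V" "norm (\<mu>_open (V - K)) < \<epsilon>"
    using \<mu>_open_compact_approx[OF V \<open>0 < \<epsilon>\<close>] by blast
  then show "\<exists>F U. closedin X F \<and> openin X U \<and> F \<subseteq> V \<and> V \<subseteq> U \<and> norm (\<mu>_open (U - F)) < \<epsilon>"
    using V compact_closed by blast
qed

lemma sandwiched_compl:
  assumes "sandwiched A"
  shows "sandwiched (topspace X - A)"
  unfolding sandwiched_def
proof (intro allI impI)
  fix \<epsilon> :: real assume "0 < \<epsilon>"
  with assms obtain F V where FV: "closedin X F" "openin X V" "F \<subseteq> A" "A \<subseteq> V" "norm (\<mu>_open (V - F)) < \<epsilon>"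
    by (rule sandwichedE)
  have "(topspace X - F) - (topspace X - V) = V - F" using openin_subset[OF FV(2)] by blast
  then have "norm (\<mu>_open ((topspace X - F) - (topspace X - V))) < \<epsilon>" using FV(5) by (simp only:)
  moreover have "closedin X (topspace X - V)" "openin X (topspace X - F)" using FV(1,2) by blast+
  moreover have "topspace X - V \<subseteq> topspace X - A" "topspace X - A \<subseteq> topspace X - F"
    using FV(3,4) by blast+
  ultimately show "\<exists>F V. closedin X F \<and> openin X V \<and> F \<subseteq> topspace X - A \<and> topspace X - A \<subseteq> V
      \<and> norm (\<mu>_open (V - F)) < \<epsilon>"
    by blast
qed

text \<open>
  A countable union is approximated from inside by finitely many of its members, because the open
  set around it is exhausted by a compact set up to small measure.
\<close>

lemma sandwiched_UN_finite:
  fixes A :: "nat \<Rightarrow> 'x set"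
  assumes A: "\<And>i. sandwiched (A i)" and "\<epsilon> > 0"
  obtains N F V where "closedin X F" "openin X V" "F \<subseteq> (\<Union>i<N. A i)" "(\<Union>i. A i) \<subseteq> V"
    "norm (\<mu>_open (V - F)) < \<epsilon>"
proof -
  \<comment> \<open>Finitely many \<open>\<delta> i\<close> add up to less than
    \<open>\<epsilon> / 2\<close>; the other half is kept for the part of the union that a compact
    set misses.\<close>
  define \<delta> where "\<delta> i = \<epsilon> / 2 * (1 / 2) ^ Suc i" for i
  have \<delta>: "\<delta> i > 0" for i using \<open>\<epsilon> > 0\<close> by (simp add: \<delta>_def)
  have "\<exists>F V. closedin X F \<and> openin X V \<and> F \<subseteq> A i \<and> A i \<subseteq> V \<and> norm (\<mu>_open (V - F)) < \<delta> i" for i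
    using A[of i] \<delta> by (simp add: sandwiched_def)
  then obtain F V where FV: "\<And>i. closedin X (F i)" "\<And>i. openin X (V i)" "\<And>i. F i \<subseteq> A i"
    "\<And>i. A i \<subseteq> V i" "\<And>i. norm (\<mu>_open (V i - F i)) < \<delta> i" by metis
  have V: "openin X (\<Union>i. V i)" using FV(2) by blast
  obtain K where K: "compactin X K" "K \<subseteq> (\<Union>i. V i)" "norm (\<mu>_open ((\<Union>i. V i) - K)) < \<epsilon> / 2"
    using \<mu>_open_compact_approx[OF V, of "\<epsilon> / 2"] \<open>\<epsilon> > 0\<close> by auto
  obtain \<F> where \<F>: "finite \<F>" "\<F> \<subseteq> range V" "K \<subseteq> \<Union>\<F>"
    using compactinD[OF K(1), of "range V"] FV(2) K(2) by blast
  obtain J where J: "finite J" "\<F> = V ` J" using finite_subset_image[OF \<F>(1,2)] by blast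
  obtain N where "\<forall>j\<in>J. j < N" using finite_nat_set_iff_bounded J(1) by blast
  then have KN: "K \<subseteq> (\<Union>i<N. V i)" using \<F>(3) J(2) by blast
  have cF: "closedin X (\<Union>i<N. F i)" using FV(1) by (intro closedin_Union) auto
  let ?V = "\<Union>i. V i" and ?F = "\<Union>i<N. F i"
  \<comment> \<open>A point of \<open>?V - ?F\<close> lies outside \<open>K\<close>, or else in some
    \<open>V i\<close> with \<open>i < N\<close> and hence in \<open>V i - F i\<close>.\<close>
  have "\<mu>_open (?V - ?F) \<le> \<mu>_open ((?V - K) \<union> (\<Union>i<N. V i - F i))"
    using KN by (intro \<mu>_open_mono) blast
  also have "\<dots> \<le> \<mu>_open (?V - K) + \<mu>_open (\<Union>i<N. V i - F i)"
    using V compact_closed[OF K(1)] FV(1,2) by (intro \<mu>_open_subadd) blast+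
  finally have "norm (\<mu>_open (?V - ?F)) \<le> norm (\<mu>_open (?V - K) + \<mu>_open (\<Union>i<N. V i - F i))"
    by (intro norm_mono \<mu>_open_nonneg)
  also have "\<dots> \<le> norm (\<mu>_open (?V - K)) + norm (\<mu>_open (\<Union>i<N. V i - F i))"
    by (rule norm_triangle_ineq)
  also have "norm (\<mu>_open (\<Union>i<N. V i - F i)) \<le> (\<Sum>i<N. norm (\<mu>_open (V i - F i)))"
    using FV(1,2) by (intro \<mu>_open_UN_le) blast
  also have "\<dots> \<le> (\<Sum>i<N. \<delta> i)" using FV(5) by (intro sum_mono less_imp_le)
  also have "\<dots> = \<epsilon> / 2 * (\<Sum>i<N. (1 / 2) ^ Suc i)" by (simp add: \<delta>_def sum_distrib_left)
  also have "(\<Sum>i<N. (1 / 2) ^ Suc i) = 1 - (1 / 2 :: real) ^ N"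
    by (induction N) simp_all
  also have "\<epsilon> / 2 * (1 - (1 / 2) ^ N) \<le> \<epsilon> / 2" using \<open>\<epsilon> > 0\<close> by (simp add: mult_left_le)
  finally have "norm (\<mu>_open (?V - ?F)) < \<epsilon>" using K(3) by simp
  moreover have "?F \<subseteq> (\<Union>i<N. A i)" "(\<Union>i. A i) \<subseteq> ?V" using FV(3,4) by blast+
  ultimately show thesis using that cF V by blast
qed

lemma sandwiched_UN:
  fixes A :: "nat \<Rightarrow> 'x set"
  assumes "\<And>i. sandwiched (A i)"
  shows "sandwiched (\<Union>i. A i)"
  unfolding sandwiched_def
proof (intro allI impI)
  fix \<epsilon> :: real assume "0 < \<epsilon>"
  obtain N F V where FV: "closedin X F" "openin X V" "F \<subseteq> (\<Union>i<N. A i)" "(\<Union>i. A i) \<subseteq> V"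
    "norm (\<mu>_open (V - F)) < \<epsilon>"
    by (rule sandwiched_UN_finite[of A, OF assms \<open>0 < \<epsilon>\<close>]) (rule that)
  have "(\<Union>i<N. A i) \<subseteq> (\<Union>i. A i)" by blast
  with FV(3) have sub: "F \<subseteq> (\<Union>i. A i)" by (rule subset_trans)
  show "\<exists>F V. closedin X F \<and> openin X V \<and> F \<subseteq> (\<Union>i. A i) \<and> (\<Union>i. A i) \<subseteq> V \<and> norm (\<mu>_open (V - F)) < \<epsilon>"
    by (rule exI[of _ F], rule exI[of _ V]) (intro conjI FV sub)
qed

lemma sandwiched_borel: "A \<in> sets (borel_of X) \<Longrightarrow> sandwiched A"
  unfolding sets_borel_of
proof (induction rule: sigma_sets.induct)
  case (Basic A)
  then show ?case by (simp add: sandwiched_open)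
next
  case (Union A)
  then show ?case by (intro sandwiched_UN)
qed (simp_all add: sandwiched_open sandwiched_compl)

text \<open>\<open>U\<close> and \<open>V\<close> may overlap although \<open>A\<close> and
  \<open>B\<close> do not. Since \<open>F\<close> and \<open>G\<close> are disjoint, the overlap is
  absorbed by the gaps \<open>U - F\<close> and \<open>V - G\<close>.\<close>

lemma \<mu>_outer_add:
  assumes A: "A \<in> sets (borel_of X)" and B: "B \<in> sets (borel_of X)" and AB: "A \<inter> B = {}"
  shows "\<mu>_outer (A \<union> B) = \<mu>_outer A + \<mu>_outer B"
proof -
  have top: "A \<subseteq> topspace X" "B \<subseteq> topspace X" "A \<union> B \<subseteq> topspace X"
    using A B sets_borel_of_subset by blast+
  have "\<exists>d. norm d < \<epsilon> \<and> \<mu>_outer (A \<union> B) \<le> \<mu>_outer A + \<mu>_outer B + d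
      \<and> \<mu>_outer A + \<mu>_outer B \<le> \<mu>_outer (A \<union> B) + d" if "\<epsilon> > 0" for \<epsilon>
  proof -
    \<comment> \<open>Two gaps make up \<open>d\<close>, and \<open>d\<close> is spent twice, once
      on the union and once on the overlap: hence a quarter for each gap.\<close>
    have e4: "\<epsilon> / 4 > 0" using that by simp
    obtain F U where U: "closedin X F" "openin X U" "F \<subseteq> A" "A \<subseteq> U" "norm (\<mu>_open (U - F)) < \<epsilon> / 4"
      by (rule sandwichedE[OF sandwiched_borel[OF A] e4])
    obtain G V where V: "closedin X G" "openin X V" "G \<subseteq> B" "B \<subseteq> V" "norm (\<mu>_open (V - G)) < \<epsilon> / 4"
      by (rule sandwichedE[OF sandwiched_borel[OF B] e4])
    define d where "d = \<mu>_open (U - F) + \<mu>_open (V - G)"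
    have d0: "0 \<le> d" by (simp add: d_def \<mu>_open_nonneg)
    have nd: "norm d < \<epsilon> / 2"
      using norm_triangle_ineq[of "\<mu>_open (U - F)" "\<mu>_open (V - G)"] U(5) V(5) by (simp add: d_def)
    have d: "\<mu>_open W \<le> d" if "W \<subseteq> (U - F) \<union> (V - G)" for W
    proof -
      have "\<mu>_open W \<le> \<mu>_open ((U - F) \<union> (V - G))" using that by (rule \<mu>_open_mono)
      also have "\<dots> \<le> d" unfolding d_def using U V by (intro \<mu>_open_subadd) auto
      finally show ?thesis .
    qed
    have UV: "\<mu>_outer A + \<mu>_outer B \<le> \<mu>_open U + \<mu>_open V"
      using U V by (intro add_mono \<mu>_outer_le)
    also have "\<dots> \<le> \<mu>_open (U \<union> V) + \<mu>_open (U \<inter> V)" by (rule \<mu>_open_supermodular)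
    also have "\<dots> \<le> (\<mu>_outer (A \<union> B) + \<mu>_open ((U \<union> V) - (F \<union> G))) + \<mu>_open (U \<inter> V)"
      using U V top by (intro add_right_mono \<mu>_open_le_outer) auto
    also have "\<dots> \<le> (\<mu>_outer (A \<union> B) + d) + d"
      using U V AB by (intro add_mono d order_refl) blast+
    finally have 1: "\<mu>_outer A + \<mu>_outer B \<le> \<mu>_outer (A \<union> B) + (d + d)" by (simp add: add.assoc)
    have "\<mu>_outer (A \<union> B) \<le> \<mu>_open (U \<union> V)" using U V by (intro \<mu>_outer_le) auto
    also have "\<dots> \<le> \<mu>_open U + \<mu>_open V" using U V by (intro \<mu>_open_subadd)
    also have "\<dots> \<le> (\<mu>_outer A + \<mu>_open (U - F)) + (\<mu>_outer B + \<mu>_open (V - G))"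
      using U V top by (intro add_mono \<mu>_open_le_outer)
    also have "\<dots> = \<mu>_outer A + \<mu>_outer B + d" by (simp add: d_def algebra_simps)
    also have "\<dots> \<le> \<mu>_outer A + \<mu>_outer B + (d + d)" using d0 by simp
    finally have 2: "\<mu>_outer (A \<union> B) \<le> \<mu>_outer A + \<mu>_outer B + (d + d)" .
    have "norm (d + d) < \<epsilon>" using norm_triangle_ineq[of d d] nd by simp
    then show ?thesis using 1 2 by blast
  qed
  then show ?thesis by (intro antisym le_eps) blast+
qed

lemma \<mu>_outer_empty: "\<mu>_outer {} = 0"
  using \<mu>_outer_open[of "{}"] by (simp add: \<mu>_open_empty)

text \<open>Finite additivity identifies the partial sums. The closed set from
  \<open>sandwiched_UN_finite\<close> lies in finitely many members, so a partial union falls short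
  by at most \<open>\<mu>_open (V - F)\<close>.\<close>

lemma \<mu>_outer_countably_additive:
  fixes A :: "nat \<Rightarrow> 'x set"
  assumes A: "range A \<subseteq> sets (borel_of X)" and disj: "disjoint_family A"
  shows "isLub UNIV (range (\<lambda>N. \<Sum>n\<le>N. \<mu>_outer (A n))) (\<mu>_outer (\<Union>n. A n))"
proof -
  have A': "A n \<in> sets (borel_of X)" for n using A by auto
  have top: "(\<Union>n. A n) \<subseteq> topspace X" using sets_borel_of_subset[OF A'] by (rule UN_least)
  have sum: "(\<Sum>n\<le>N. \<mu>_outer (A n)) = \<mu>_outer (\<Union>n\<le>N. A n)" for N
  proof (induction N)
    case (Suc N)
    have "A (Suc N) \<inter> A n = {}" if "n \<le> N" for n
      using that by (intro disjoint_family_onD[OF disj]) auto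
    then have "A (Suc N) \<inter> (\<Union>n\<le>N. A n) = {}" by blast
    then have "\<mu>_outer (A (Suc N) \<union> (\<Union>n\<le>N. A n)) = \<mu>_outer (A (Suc N)) + \<mu>_outer (\<Union>n\<le>N. A n)"
      using A' by (intro \<mu>_outer_add) auto
    then show ?case using Suc by (simp add: atMost_Suc add.commute)
  qed simp
  show ?thesis
  proof (rule isLub_eps)
    fix x assume "x \<in> range (\<lambda>N. \<Sum>n\<le>N. \<mu>_outer (A n))"
    then obtain N where "x = \<mu>_outer (\<Union>n\<le>N. A n)" by (auto simp only: sum)
    moreover have "(\<Union>n\<le>N. A n) \<subseteq> (\<Union>n. A n)" by blast
    ultimately show "x \<le> \<mu>_outer (\<Union>n. A n)" using \<mu>_outer_mono[OF _ top] by simp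
  next
    fix \<epsilon> :: real assume "0 < \<epsilon>"
    obtain N F V where FV: "closedin X F" "openin X V" "F \<subseteq> (\<Union>i<N. A i)" "(\<Union>i. A i) \<subseteq> V"
      "norm (\<mu>_open (V - F)) < \<epsilon>"
      by (rule sandwiched_UN_finite[of A, OF sandwiched_borel[OF A'] \<open>0 < \<epsilon>\<close>]) (rule that)
    \<comment> \<open>Partial sums include the index \<open>N\<close>, one member more than the
      union around \<open>F\<close>; inclusion is enough.\<close>
    let ?B = "\<Union>n\<le>N. A n"
    have "(\<Union>i<N. A i) \<subseteq> ?B" by (rule UN_mono) auto
    then have FB: "F \<subseteq> ?B" by (rule subset_trans[OF FV(3)])
    have Btop: "?B \<subseteq> topspace X" using sets_borel_of_subset[OF A'] by (rule UN_least)
    have "\<mu>_outer (\<Union>n. A n) \<le> \<mu>_outer ?B + \<mu>_open (V - F)"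
      using \<mu>_outer_le[OF FV(2,4)] \<mu>_open_le_outer[OF FV(1,2) FB Btop] by (rule order_trans)
    then have "\<mu>_outer (\<Union>n. A n) - \<mu>_outer ?B \<le> \<mu>_open (V - F)"
      by (simp only: diff_le_eq add.commute)
    moreover have "?B \<subseteq> (\<Union>n. A n)" by blast
    then have "\<mu>_outer ?B \<le> \<mu>_outer (\<Union>n. A n)" using top by (rule \<mu>_outer_mono)
    ultimately have "norm (\<mu>_outer (\<Union>n. A n) - \<mu>_outer ?B) \<le> norm (\<mu>_open (V - F))"
      by (intro norm_mono) simp_all
    then have "norm (\<mu>_outer (\<Union>n. A n) - (\<Sum>n\<le>N. \<mu>_outer (A n))) < \<epsilon>"
      unfolding sum using FV(5) by (rule le_less_trans)
    then show "\<exists>x\<in>range (\<lambda>N. \<Sum>n\<le>N. \<mu>_outer (A n)). norm (\<mu>_outer (\<Union>n. A n) - x) < \<epsilon>"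
      by (rule bexI[OF _ rangeI])
  qed
qed

end

text \<open>Slice \<open>k\<close> is the part of \<open>t\<close> between the heights
  \<open>k * h\<close> and \<open>(k + 1) * h\<close>.\<close>

lemma sum_layers:
  fixes t h :: real
  assumes "0 < h" "0 \<le> t"
  shows "(\<Sum>k<m. min (max (t - real k * h) 0) h) = min t (real m * h)"
proof (induction m)
  case (Suc m)
  have "min t (real m * h) + min (max (t - real m * h) 0) h = min t (real m * h + h)"
    using assms by (auto simp: min_def max_def)
  then show ?case using Suc by (simp add: algebra_simps)
qed (use assms in simp)

context vmeasure_trace
begin

text \<open>The indicator of \<open>A\<close> is itself elementary and compares with
  \<open>f\<close> from either side. This is how a competing measure is tied to \<open>\<pi>\<close>
  in the uniqueness proof.\<close>

lemma
  assumes f: "f \<in> borel_measurable M" "\<And>x. 0 \<le> f x" "\<And>x. f x \<le> 1"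
    and off: "\<And>x. x \<in> space M - K \<Longrightarrow> f x = 0"
  shows order_integral_le: "\<And>A. A \<in> sets M \<Longrightarrow> (\<And>x. x \<notin> A \<Longrightarrow> f x = 0) \<Longrightarrow> order_integral M \<nu> f \<le> trace A"
    and order_integral_ge: "\<And>A. A \<in> sets M \<Longrightarrow> (\<And>x. x \<in> A \<Longrightarrow> f x = 1) \<Longrightarrow> trace A \<le> order_integral M \<nu> f"
proof -
  let ?I = "simple_vector_integral M trace"
  obtain L where L: "order_nn_integral M \<nu> (\<lambda>x. ennreal (f x)) = Finite L"
    "\<And>\<psi>. elementary M \<psi> \<Longrightarrow> (\<And>x. x \<in> space M \<Longrightarrow> f x \<le> \<psi> x) \<Longrightarrow> L \<le> ?I \<psi>"
    "\<And>\<psi>. elementary M \<psi> \<Longrightarrow> (\<And>x. x \<in> space M \<Longrightarrow> \<psi> x \<le> f x) \<Longrightarrow> ?I \<psi> \<le> L"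
    by (rule order_nn_integral_bounded[of f 1]) (use assms in auto)
  \<comment> \<open>\<open>order_integral\<close> also evaluates the integral of the negative part;
    here that is the zero function, and its integral must be shown to be zero.\<close>
  obtain Z where Z: "order_nn_integral M \<nu> (\<lambda>x. ennreal 0) = Finite Z"
    "\<And>\<psi>. elementary M \<psi> \<Longrightarrow> (\<And>x. x \<in> space M \<Longrightarrow> 0 \<le> \<psi> x) \<Longrightarrow> Z \<le> ?I \<psi>"
    "\<And>\<psi>. elementary M \<psi> \<Longrightarrow> (\<And>x. x \<in> space M \<Longrightarrow> \<psi> x \<le> 0) \<Longrightarrow> ?I \<psi> \<le> Z"
    by (rule order_nn_integral_bounded[of "\<lambda>x. 0" 1]) auto
  have el: "elementary M (\<lambda>x. 1 * indicator A x)" if "A \<in> sets M" for A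
    using trace.simple_function_const_indicator[OF that, of 1] by (simp add: elementary_def)
  have "Z = 0"
    using Z(2,3)[OF el, of "{}"] trace.simple_vector_integral_indicator[of "{}" 1]
    by (simp add: trace.empty)
  moreover have "max (f x) 0 = f x" "max (- f x) 0 = 0" for x
    using f(2)[of x] by simp_all
  ultimately have eq: "order_integral M \<nu> f = L"
    unfolding order_integral_def using L(1) Z(1) by simp
  fix A assume A: "A \<in> sets M"
  have I: "?I (\<lambda>x. 1 * indicator A x) = trace A"
    using trace.simple_vector_integral_indicator[OF A, of 1] by simp
  show "order_integral M \<nu> f \<le> trace A" if z: "\<And>x. x \<notin> A \<Longrightarrow> f x = 0"
    unfolding eq I[symmetric]
  proof (rule L(2)[OF el[OF A]])
    show "f x \<le> 1 * indicator A x" for x using z[of x] f(3)[of x] by (cases "x \<in> A") auto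
  qed
  show "trace A \<le> order_integral M \<nu> f" if z: "\<And>x. x \<in> A \<Longrightarrow> f x = 1"
    unfolding eq I[symmetric]
  proof (rule L(3)[OF el[OF A]])
    show "1 * indicator A x \<le> f x" for x using z[of x] f(2)[of x] by (cases "x \<in> A") auto
  qed
qed

end

context riesz
begin

subsection \<open>Representation\<close>

definition \<mu> :: "'x set \<Rightarrow> 'e top" where
  "\<mu> = (\<lambda>A\<in>sets (borel_of X). Finite (\<mu>_outer A))"

lemma \<mu>_eq: "A \<in> sets (borel_of X) \<Longrightarrow> \<mu> A = Finite (\<mu>_outer A)"
  by (simp add: \<mu>_def)

lemma \<mu>_open_eq: "openin X V \<Longrightarrow> \<mu> V = Finite (\<mu>_open V)"
  by (simp add: \<mu>_eq openin_borel_of \<mu>_outer_open)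

lemma compactin_borel_of: "compactin X K \<Longrightarrow> K \<in> sets (borel_of X)"
  by (rule closedin_borel_of[OF compact_closed])

lemma positive_vector_measure_\<mu>: "positive_vector_measure (borel_of X) \<mu>"
  unfolding positive_vector_measure_def
proof (intro conjI allI impI)
  show "\<mu> \<in> sets (borel_of X) \<rightarrow>\<^sub>E {a. 0 \<le> a}"
    unfolding \<mu>_def using \<mu>_outer_nonneg[OF sets_borel_of_subset] by (intro restrict_PiE_iff[THEN iffD2]) (simp add: zero_top_def)
  show "\<mu> {} = 0" by (simp add: \<mu>_eq \<mu>_outer_empty zero_top_def)
  fix A :: "nat \<Rightarrow> 'x set" assume A: "range A \<subseteq> sets (borel_of X)" "disjoint_family A"
  then have A': "A n \<in> sets (borel_of X)" for n by auto
  have "isLub UNIV (Finite ` range (\<lambda>N. \<Sum>n\<le>N. \<mu>_outer (A n))) (Finite (\<mu>_outer (\<Union>n. A n)))"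
    using \<mu>_outer_countably_additive[OF A] by (subst isLub_Finite_iff) simp_all
  moreover have "(\<Sum>n\<le>N. \<mu> (A n)) = Finite (\<Sum>n\<le>N. \<mu>_outer (A n))" for N
    using A' by (simp add: \<mu>_eq sum_Finite)
  ultimately show "isLub UNIV (range (\<lambda>N. \<Sum>n\<le>N. \<mu> (A n))) (\<mu> (\<Union>n. A n))"
    using A' by (simp add: \<mu>_eq image_image)
qed

text \<open>The constructed measure is finite, so its trace on the whole space is the measure
  itself; the lemmas on traces thus serve existence as well as uniqueness.\<close>

sublocale \<mu>: vmeasure_trace "borel_of X" \<mu> "topspace X"
  by unfold_locales
    (use positive_vector_measure_\<mu> in \<open>simp_all add: openin_borel_of \<mu>_open_eq\<close>)

lemma \<mu>_trace: "A \<in> sets (borel_of X) \<Longrightarrow> \<mu>.trace A = \<mu>_outer A"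
  using sets_borel_of_subset[of A X] by (simp add: \<mu>.trace_def \<mu>_eq Int_absorb2)

lemma pi_le_\<mu>_outer:
  assumes f: "prec_set X f K" and "K \<subseteq> topspace X"
  shows "\<pi> f \<le> \<mu>_outer K"
  using assms(2)
proof (rule \<mu>_outer_greatest)
  fix V assume "K \<subseteq> V"
  with f have "prec_set X f V" by (rule prec_set_mono)
  then show "\<pi> f \<le> \<mu>_open V" by (rule pi_le_\<mu>_open)
qed

text \<open>Every function carried by the open set where \<open>f > 1 - \<delta>\<close> and bounded
  by one is at most \<open>f / (1 - \<delta>)\<close>; letting \<open>\<delta>\<close> tend to zero
  removes the factor.\<close>

lemma \<mu>_outer_le_pi:
  assumes f: "f \<in> C0 X" "\<And>x. 0 \<le> f x" and K: "K \<subseteq> topspace X" "\<And>x. x \<in> K \<Longrightarrow> 1 \<le> f x"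
  shows "\<mu>_outer K \<le> \<pi> f"
proof (rule le_eps)
  fix \<epsilon> :: real assume "0 < \<epsilon>"
  define n where "n = norm (\<mu>_outer K) + 1"
  have "0 < n" by (simp add: n_def add_nonneg_pos)
  \<comment> \<open>The cap \<open>1 / 2\<close> keeps \<open>1 - \<delta>\<close> positive, and the
    second bound makes \<open>\<delta>\<close> times \<open>\<mu>_outer K\<close> smaller than
    \<open>\<epsilon>\<close> in norm.\<close>
  define \<delta> where "\<delta> = min (1 / 2) (\<epsilon> / (2 * n))"
  have \<delta>: "0 < \<delta>" "\<delta> < 1" "\<delta> \<le> \<epsilon> / (2 * n)" using \<open>0 < \<epsilon>\<close> \<open>0 < n\<close> by (simp_all add: \<delta>_def min_def)
  define V where "V = {x \<in> topspace X. f x \<in> {1 - \<delta><..}}"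
  have V: "openin X V"
    unfolding V_def using C0_continuous[OF f(1)] by (rule openin_continuous_map_preimage) simp
  have "K \<subseteq> V" unfolding V_def using K \<delta>(1) by fastforce
  have "\<mu>_open V \<le> (1 / (1 - \<delta>)) *\<^sub>R \<pi> f"
  proof (rule \<mu>_open_least)
    fix g assume g: "prec_set X g V"
    have "g x \<le> 1 / (1 - \<delta>) * f x" for x
    proof (cases "x \<in> V")
      case True
      then have "1 - \<delta> < f x" by (simp add: V_def)
      moreover have "g x * (1 - \<delta>) \<le> 1 * (1 - \<delta>)"
        using prec_set_range[OF g, of x] \<delta>(2) by (intro mult_right_mono) simp_all
      ultimately have "g x * (1 - \<delta>) \<le> f x" by simp
      then show ?thesis using \<delta>(2) by (simp add: field_simps)
    next
      case False
      then show ?thesis using prec_set_off[OF g] f(2)[of x] \<delta>(2) by simp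
    qed
    then have "\<pi> g \<le> \<pi> (\<lambda>x. 1 / (1 - \<delta>) * f x)"
      by (rule pi_mono[OF prec_set_C0[OF g] C0_cmult[OF f(1)]])
    then show "\<pi> g \<le> (1 / (1 - \<delta>)) *\<^sub>R \<pi> f" by (simp only: pi_cmult[OF f(1)])
  qed
  then have "\<mu>_outer K \<le> (1 / (1 - \<delta>)) *\<^sub>R \<pi> f"
    using \<mu>_outer_le[OF V \<open>K \<subseteq> V\<close>] by (rule order_trans[rotated])
  then have "(1 - \<delta>) *\<^sub>R \<mu>_outer K \<le> (1 - \<delta>) *\<^sub>R ((1 / (1 - \<delta>)) *\<^sub>R \<pi> f)"
    using \<delta>(2) by (intro scaleR_left_mono) simp_all
  then have "\<mu>_outer K \<le> \<pi> f + \<delta> *\<^sub>R \<mu>_outer K"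
    using \<delta>(2) by (simp add: scaleR_left_diff_distrib diff_le_eq)
  moreover have "norm (\<delta> *\<^sub>R \<mu>_outer K) < \<epsilon>"
  proof -
    have "norm (\<delta> *\<^sub>R \<mu>_outer K) \<le> \<delta> * n" using \<delta>(1) by (simp add: n_def)
    also have "\<dots> \<le> \<epsilon> / (2 * n) * n" using \<delta>(3) \<open>0 < n\<close> by (intro mult_right_mono) simp_all
    also have "\<dots> < \<epsilon>" using \<open>0 < \<epsilon>\<close> \<open>0 < n\<close> by simp
    finally show ?thesis .
  qed
  ultimately show "\<exists>e. norm e < \<epsilon> \<and> \<mu>_outer K \<le> \<pi> f + e" by blast
qed

text \<open>
  Layer cake: \<open>f\<close> is cut into slices of height \<open>h\<close>, and the \<open>k\<close>-th slice divided by \<open>h\<close> lies between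
  the indicators of \<open>{f \<ge> (k + 1) h}\<close> and \<open>{f \<ge> k h}\<close>. Only for \<open>k \<ge> 1\<close> is the latter set compact.
\<close>

lemma dyadic_integral_bounds:
  assumes f: "f \<in> C0 X" "\<And>x. 0 \<le> f x" "\<And>x. f x \<le> real N"
    and B: "\<forall>g\<in>C0 X. (\<forall>x. 0 \<le> g x \<and> g x \<le> 1) \<longrightarrow> norm (\<pi> g) \<le> B"
  shows "simple_vector_integral (borel_of X) \<mu>.trace (dyadic (borel_of X) N f n) \<le> \<pi> f"
    and "norm (\<pi> f - simple_vector_integral (borel_of X) \<mu>.trace (dyadic (borel_of X) N f n)) \<le> B / 2 ^ n"
proof -
  define h :: real where "h = 1 / 2 ^ n"
  have h: "0 < h" by (simp add: h_def)
  define m where "m = N * 2 ^ n"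
  define A where "A k = {x \<in> topspace X. real k * h \<le> f x}" for k :: nat
  define s where "s k x = min (max (f x - real k * h) 0) h" for k :: nat and x
  have cont: "continuous_map X euclideanreal f" using C0_continuous[OF f(1)] .
  have A: "A k \<in> sets (borel_of X)" for k
    unfolding A_def by (rule closedin_borel_of[OF closedin_level(1)[OF cont]])
  have s0: "0 \<le> s k x" "s k x \<le> h" for k x using h by (auto simp: s_def)
  have s: "s k \<in> C0 X" for k
  proof (rule C0_dominated[OF f(1)])
    show "continuous_map X euclideanreal (s k)"
      unfolding s_def
      by (intro continuous_map_real_min continuous_map_real_max continuous_map_diff cont
          continuous_map_canonical_const)
    have "0 \<le> real k * h" using h by simp
    then have "max (f x - real k * h) 0 \<le> f x" for x using f(2)[of x] by (intro max.boundedI) linarith+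
    then have "s k x \<le> f x" for x unfolding s_def by (rule min.coboundedI1)
    then show "\<bar>s k x\<bar> \<le> 1 * \<bar>f x\<bar>" for x using s0 f(2) by simp
    show "s k x = 0" if "x \<notin> topspace X" for x using C0_off[OF f(1) that] h by (simp add: s_def max_def min_def)
  qed simp
  \<comment> \<open>Scaled to values between zero and one, a slice can be compared with sets and
    obeys the bound \<open>B\<close>.\<close>
  define q where "q k x = (1 / h) * s k x" for k x
  have q: "q k \<in> C0 X" for k unfolding q_def by (rule C0_cmult[OF s])
  have q01: "0 \<le> q k x" "q k x \<le> 1" for k x using s0[of k x] h by (simp_all add: q_def)
  have pi_s: "\<pi> (s k) = h *\<^sub>R \<pi> (q k)" for k
    using pi_cmult[OF s, of "1 / h" k] h by (simp add: q_def[abs_def])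
  have "(\<Sum>k<m. s k x) = f x" for x
    using sum_layers[OF h f(2)[of x], where m = m] f(3)[of x] by (simp add: s_def m_def h_def)
  then have sum: "\<pi> f = (\<Sum>k<m. \<pi> (s k))"
    using pi_sum[where I = "{..<m}" and f = s, OF _ s] by simp
  have lower: "h *\<^sub>R \<mu>_outer (A (Suc k)) \<le> \<pi> (s k)" for k
  proof -
    have "\<mu>_outer (A (Suc k)) \<le> \<pi> (q k)"
    proof (rule \<mu>_outer_le_pi[OF q])
      show "A (Suc k) \<subseteq> topspace X" by (auto simp: A_def)
      fix x assume "x \<in> A (Suc k)"
      then have "s k x = h" using h by (simp add: A_def s_def algebra_simps min_def max_def)
      then show "1 \<le> q k x" using h by (simp add: q_def)
    qed (rule q01)
    then show ?thesis unfolding pi_s using h by (intro scaleR_left_mono) simp_all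
  qed
  have upper: "\<pi> (s (Suc k)) \<le> h *\<^sub>R \<mu>_outer (A (Suc k))" for k
  proof -
    have "A (Suc k) = {x \<in> topspace X. real (Suc k) * h \<le> \<bar>f x\<bar>}" using f(2) by (simp add: A_def)
    moreover have "0 < real (Suc k) * h" using h by simp
    ultimately have cA: "compactin X (A (Suc k))" using compactin_C0_level[OF f(1)] by simp
    have "prec_set X (q (Suc k)) (A (Suc k))"
    proof (rule prec_setI[OF C0_continuous[OF q] C0_off[OF q] q01 cA _ subset_refl])
      fix x assume "q (Suc k) x \<noteq> 0"
      then have "s (Suc k) x \<noteq> 0" by (simp add: q_def)
      then have "real (Suc k) * h < f x" using h by (auto simp: s_def max_def split: if_splits)
      moreover have "x \<in> topspace X" using \<open>s (Suc k) x \<noteq> 0\<close> C0_off[OF s] by metis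
      ultimately show "x \<in> A (Suc k)" by (simp add: A_def)
    qed
    then have "\<pi> (q (Suc k)) \<le> \<mu>_outer (A (Suc k))"
      by (rule pi_le_\<mu>_outer[OF _ compactin_subset_topspace[OF cA]])
    then show ?thesis unfolding pi_s using h by (intro scaleR_left_mono) simp_all
  qed
  let ?I = "simple_vector_integral (borel_of X) \<mu>.trace (dyadic (borel_of X) N f n)"
  have "?I = (\<Sum>k\<in>{1..m}. h *\<^sub>R \<mu>.trace (A k))"
    unfolding dyadic_def[abs_def] h_def[symmetric] m_def[symmetric]
    using \<mu>.trace.simple_vector_integral_sum_indicator[of "{1..m}" A "\<lambda>k. h"] A
    by (simp add: A_def space_borel_of h_def)
  also have "\<dots> = (\<Sum>k<m. h *\<^sub>R \<mu>_outer (A (Suc k)))"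
    using A by (simp add: \<mu>_trace sum.atLeast1_atMost_eq)
  finally have I: "?I = (\<Sum>k<m. h *\<^sub>R \<mu>_outer (A (Suc k)))" .
  show le: "?I \<le> \<pi> f" unfolding I sum by (intro sum_mono lower)
  \<comment> \<open>The upper estimates start with slice one, which shifts the sum by one index.
    Slice zero remains as the error, of norm at most \<open>h * B\<close>.\<close>
  have "\<pi> f \<le> \<pi> (s 0) + ?I"
  proof (cases m)
    case 0
    then show ?thesis using pi_nonneg[OF s s0(1), of 0] by (simp add: I sum)
  next
    case (Suc j)
    have "\<pi> f = \<pi> (s 0) + (\<Sum>k<j. \<pi> (s (Suc k)))" unfolding sum Suc by (rule sum.lessThan_Suc_shift)
    also have "(\<Sum>k<j. \<pi> (s (Suc k))) \<le> (\<Sum>k<j. h *\<^sub>R \<mu>_outer (A (Suc k)))" by (intro sum_mono upper)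
    also have "\<dots> \<le> ?I"
      unfolding I Suc sum.lessThan_Suc using h \<mu>_outer_nonneg[OF sets_borel_of_subset[OF A]]
      by (simp add: scaleR_nonneg_nonneg)
    finally show ?thesis by simp
  qed
  then have "\<pi> f - ?I \<le> \<pi> (s 0)" by (simp add: diff_le_eq)
  then have "norm (\<pi> f - ?I) \<le> norm (\<pi> (s 0))" using le by (intro norm_mono) simp_all
  also have "\<dots> = h * norm (\<pi> (q 0))" using h by (simp add: pi_s)
  also have "\<dots> \<le> h * B" using h B q q01 by (intro mult_left_mono) simp_all
  finally show "norm (\<pi> f - ?I) \<le> B / 2 ^ n" by (simp add: h_def)
qed

lemma order_nn_integral_C0:
  assumes f: "f \<in> C0 X" "\<And>x. 0 \<le> f x"
  shows "order_nn_integral (borel_of X) \<mu> (\<lambda>x. ennreal (f x)) = Finite (\<pi> f)"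
proof -
  obtain N where "\<And>x. \<bar>f x\<bar> \<le> real N" by (rule C0_bounded[OF f(1)]) (rule that)
  then have N: "f x \<le> real N" for x by (meson abs_le_D1)
  obtain B where B: "\<forall>g\<in>C0 X. (\<forall>x. 0 \<le> g x \<and> g x \<le> 1) \<longrightarrow> norm (\<pi> g) \<le> B"
    using pi_bounded by (elim exE)
  note bounds = dyadic_integral_bounds[OF f N B]
  have "elementary_approx (borel_of X) (dyadic (borel_of X) N f) (\<lambda>x. ennreal (f x))"
    using borel_measurable_borel_of[OF C0_continuous[OF f(1)]] f(2) N by (rule elementary_approx_dyadic)
  moreover have "isLub UNIV (range (\<lambda>n. simple_vector_integral (borel_of X) \<mu>.trace (dyadic (borel_of X) N f n))) (\<pi> f)"
  proof (rule isLub_eps)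
    fix \<epsilon> :: real assume "0 < \<epsilon>"
    obtain n where "B / \<epsilon> < 2 ^ n" using real_arch_pow[of 2 "B / \<epsilon>"] by auto
    then have "B / 2 ^ n < \<epsilon>" using \<open>0 < \<epsilon>\<close> by (simp add: field_simps)
    with bounds(2)[of n] show "\<exists>x\<in>range (\<lambda>n. simple_vector_integral (borel_of X) \<mu>.trace (dyadic (borel_of X) N f n)). norm (\<pi> f - x) < \<epsilon>"
      by (intro bexI[OF _ rangeI[where x = n]]) (rule le_less_trans)
  next
    fix x assume "x \<in> range (\<lambda>n. simple_vector_integral (borel_of X) \<mu>.trace (dyadic (borel_of X) N f n))"
    then show "x \<le> \<pi> f" using bounds(1) by (elim rangeE) simp
  qed
  ultimately show ?thesis
    by (intro \<mu>.order_nn_integral_eq) (simp_all add: space_borel_of)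
qed

lemma represents_C0:
  assumes f: "f \<in> C0 X"
  shows "represents_at X \<mu> \<pi> f"
  unfolding represents_at_def order_integrable_def
proof (intro conjI)
  show "f \<in> borel_measurable (borel_of X)" by (rule borel_measurable_borel_of[OF C0_continuous[OF f]])
  show "order_nn_integral (borel_of X) \<mu> (\<lambda>x. ennreal \<bar>f x\<bar>) \<in> range Finite"
    using order_nn_integral_C0[OF C0_abs[OF f]] by simp
  have "f = (\<lambda>x. max (f x) 0 - max (- f x) 0)" by (rule ext) (simp add: max_def)
  then have "\<pi> f = \<pi> (\<lambda>x. max (f x) 0 - max (- f x) 0)" by (rule arg_cong)
  also have "\<dots> = \<pi> (\<lambda>x. max (f x) 0) - \<pi> (\<lambda>x. max (- f x) 0)"
    by (rule pi_diff[OF C0_pos_part[OF f] C0_pos_part[OF C0_minus[OF f]]])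
  finally show "\<pi> f = order_integral (borel_of X) \<mu> f"
    using order_nn_integral_C0[OF C0_pos_part[OF f]] order_nn_integral_C0[OF C0_pos_part[OF C0_minus[OF f]]]
    by (simp add: order_integral_def)
qed

subsection \<open>Regularity\<close>

text \<open>Any \<open>f \<prec> V\<close> is carried by a compact \<open>K \<subseteq> V\<close>,
  and \<open>\<pi> f \<le> \<mu>_outer K\<close> because \<open>f\<close> competes for every open
  set around \<open>K\<close>.\<close>

lemma inner_regular_\<mu>:
  assumes V: "openin X V"
  shows "inner_regular_at X \<mu> V"
  unfolding inner_regular_at_def
proof -
  have "isLub UNIV {\<mu>_outer K | K. compactin X K \<and> K \<subseteq> V} (\<mu>_open V)"
    unfolding isLub_UNIV_iff
  proof (intro conjI ballI allI impI)
    fix x assume "x \<in> {\<mu>_outer K | K. compactin X K \<and> K \<subseteq> V}"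
    then show "x \<le> \<mu>_open V" using \<mu>_outer_le[OF V] by auto
  next
    fix b assume b: "\<forall>x\<in>{\<mu>_outer K | K. compactin X K \<and> K \<subseteq> V}. x \<le> b"
    show "\<mu>_open V \<le> b"
    proof (rule \<mu>_open_least)
      fix f assume f: "prec_set X f V"
      from f obtain K where K: "continuous_map X euclideanreal f" "\<And>x. x \<notin> topspace X \<Longrightarrow> f x = 0"
        "\<And>x. 0 \<le> f x" "\<And>x. f x \<le> 1" "compactin X K" "\<And>x. f x \<noteq> 0 \<Longrightarrow> x \<in> K" "K \<subseteq> V"
        by (rule prec_setE) (rule that)
      have "prec_set X f K" by (rule prec_setI[OF K(1-6) subset_refl])
      then have "\<pi> f \<le> \<mu>_outer K" by (rule pi_le_\<mu>_outer[OF _ compactin_subset_topspace[OF K(5)]])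
      also have "\<dots> \<le> b" using b K(5,7) by auto
      finally show "\<pi> f \<le> b" .
    qed
  qed
  moreover have "{\<mu>_outer K | K. compactin X K \<and> K \<subseteq> V} \<noteq> {}" using compactin_empty by auto
  ultimately have "isLub UNIV (Finite ` {\<mu>_outer K | K. compactin X K \<and> K \<subseteq> V}) (Finite (\<mu>_open V))"
    by (rule isLub_Finite_iff[THEN iffD2, rotated])
  moreover have "Finite ` {\<mu>_outer K | K. compactin X K \<and> K \<subseteq> V} = {\<mu> K | K. compactin X K \<and> K \<subseteq> V}"
    unfolding setcompr_eq_image image_image
    by (rule image_cong) (simp_all add: \<mu>_eq compactin_borel_of)
  ultimately show "isLub UNIV {\<mu> K | K. compactin X K \<and> K \<subseteq> V} (\<mu> V)"
    using \<mu>_open_eq[OF V] by simp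
qed

lemma outer_regular_\<mu>:
  assumes A: "A \<in> sets (borel_of X)"
  shows "outer_regular_at X \<mu> A"
proof -
  have top: "A \<subseteq> topspace X" using sets_borel_of_subset[OF A] .
  then have "{\<mu>_open V | V. openin X V \<and> A \<subseteq> V} \<noteq> {}" using openin_topspace by auto
  then have "isGlb UNIV (Finite ` {\<mu>_open V | V. openin X V \<and> A \<subseteq> V}) (Finite (\<mu>_outer A))"
    using \<mu>_outer_glb[OF top] by (rule isGlb_Finite_iff[THEN iffD2])
  moreover have "Finite ` {\<mu>_open V | V. openin X V \<and> A \<subseteq> V} = {\<mu> V | V. openin X V \<and> A \<subseteq> V}"
    unfolding setcompr_eq_image image_image by (rule image_cong) (simp_all add: \<mu>_open_eq)
  ultimately show ?thesis by (simp add: outer_regular_at_def \<mu>_eq[OF A])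
qed

lemma regular_borel_measure_\<mu>: "regular_borel_measure X \<mu>"
  unfolding regular_borel_measure_def
  using positive_vector_measure_\<mu> inner_regular_\<mu> outer_regular_\<mu> \<mu>_eq[OF compactin_borel_of] by simp

text \<open>Each open \<open>V\<close> around \<open>K\<close> leaves room for a Urysohn function
  that is one on \<open>K\<close>, so the infimum gets below \<open>\<mu>_open V\<close>; the other
  bound is \<open>\<mu>_outer_le_pi\<close>.\<close>

lemma \<mu>_compact_glb:
  assumes K: "compactin X K"
  shows "isGlb UNIV {\<pi> f | f. set_prec X K f} (\<mu>_outer K)"
proof -
  have top: "K \<subseteq> topspace X" using compactin_subset_topspace[OF K] .
  show ?thesis
    unfolding isGlb_UNIV_iff
  proof (intro conjI ballI allI impI)
    fix x assume "x \<in> {\<pi> f | f. set_prec X K f}"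
    then obtain f where f: "x = \<pi> f" "set_prec X K f" by auto
    then have C: "f \<in> C0 X" using Cc_imp_C0 by (simp add: set_prec_def)
    have "0 \<le> f y" for y
      using f(2) C0_off[OF C, of y] by (cases "y \<in> topspace X") (simp_all add: set_prec_def)
    then show "\<mu>_outer K \<le> x" unfolding f(1) using f(2) top C
      by (intro \<mu>_outer_le_pi) (simp_all add: set_prec_def)
  next
    fix b assume b: "\<forall>x\<in>{\<pi> f | f. set_prec X K f}. b \<le> x"
    show "b \<le> \<mu>_outer K"
    proof (rule \<mu>_outer_greatest[OF top])
      fix V assume V: "openin X V" "K \<subseteq> V"
      obtain f where f: "prec_set X f V" "set_prec X K f" by (rule urysohn[OF K V])
      have "b \<le> \<pi> f" using b f(2) by auto
      also have "\<dots> \<le> \<mu>_open V" by (rule pi_le_\<mu>_open[OF f(1)])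
      finally show "b \<le> \<mu>_open V" .
    qed
  qed
qed

subsection \<open>Uniqueness\<close>

text \<open>\<open>\<pi> f \<le> \<nu> K\<close> holds on a compact carrier \<open>K\<close> of
  \<open>f\<close>, and \<open>\<nu> A \<le> \<pi> f\<close> when \<open>f = 1\<close> on a compact
  \<open>A\<close>. Inner regularity then makes \<open>\<nu> V\<close> a supremum in which
  \<open>\<nu>\<close> no longer occurs.\<close>

lemma regular_borel_measure_open_lub:
  assumes reg: "regular_borel_measure X \<nu>" and rep: "\<And>f. f \<in> Cc X \<Longrightarrow> represents_at X \<nu> \<pi> f"
    and V: "openin X V"
  shows "isLub UNIV {Finite (\<pi> f) | f. prec_set X f V} (\<nu> V)"
proof -
  have trace: "vmeasure_trace (borel_of X) \<nu> K" if "compactin X K" for K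
    using reg that compactin_borel_of[OF that] by unfold_locales (simp_all add: regular_borel_measure_def)
  have trace_self: "Finite (vmeasure_trace.trace \<nu> K K) = \<nu> K" if "compactin X K" for K
    using vmeasure_trace.Finite_trace[OF trace[OF that] compactin_borel_of[OF that]] by simp
  interpret vmeasure "borel_of X" \<nu>
    using reg by unfold_locales (simp add: regular_borel_measure_def)
  have inner: "isLub UNIV {\<nu> K | K. compactin X K \<and> K \<subseteq> V} (\<nu> V)"
    using reg V by (simp add: regular_borel_measure_def inner_regular_at_def)
  \<comment> \<open>\<open>f\<close> is integrated against the trace on its carrier
    \<open>K\<close>, which is finite even if \<open>\<nu> V\<close> is not.\<close>
  have main: "Finite (\<pi> f) \<le> \<nu> K" "\<And>A. compactin X A \<Longrightarrow> A \<subseteq> K \<Longrightarrow> (\<And>x. x \<in> A \<Longrightarrow> f x = 1) \<Longrightarrow> \<nu> A \<le> Finite (\<pi> f)"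
    if f: "prec_set X f V" and K: "compactin X K" "\<And>x. f x \<noteq> 0 \<Longrightarrow> x \<in> K" for f K
  proof -
    interpret K: vmeasure_trace "borel_of X" \<nu> K by (rule trace[OF K(1)])
    have Cc: "f \<in> Cc X" using f by (simp add: prec_set_def)
    have pi: "\<pi> f = order_integral (borel_of X) \<nu> f" using rep[OF Cc] by (simp add: represents_at_def)
    have meas: "f \<in> borel_measurable (borel_of X)"
      by (rule borel_measurable_borel_of[OF C0_continuous[OF Cc_imp_C0[OF Cc]]])
    have off: "f x = 0" if "x \<in> space (borel_of X) - K" for x using K(2)[of x] that by auto
    have f01: "0 \<le> f x" "f x \<le> 1" for x using prec_set_range[OF f] by simp_all
    have "\<pi> f \<le> K.trace K"
      unfolding pi
    proof (rule K.order_integral_le[OF meas f01 off compactin_borel_of[OF K(1)]])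
      show "f x = 0" if "x \<notin> K" for x using K(2)[of x] that by auto
    qed
    then show "Finite (\<pi> f) \<le> \<nu> K" by (simp flip: trace_self[OF K(1)])
    fix A assume A: "compactin X A" "A \<subseteq> K" "\<And>x. x \<in> A \<Longrightarrow> f x = 1"
    have "K.trace A \<le> \<pi> f"
      unfolding pi by (rule K.order_integral_ge[OF meas f01 off compactin_borel_of[OF A(1)] A(3)])
    then have "Finite (K.trace A) \<le> Finite (\<pi> f)" by simp
    then show "\<nu> A \<le> Finite (\<pi> f)"
      using A(2) by (simp add: K.Finite_trace[OF compactin_borel_of[OF A(1)]] Int_absorb2)
  qed
  show ?thesis
    unfolding isLub_UNIV_iff
  proof (intro conjI ballI allI impI)
    fix x assume "x \<in> {Finite (\<pi> f) | f. prec_set X f V}"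
    then obtain f where f: "x = Finite (\<pi> f)" "prec_set X f V" by auto
    from f(2) obtain K where K: "compactin X K" "\<And>x. f x \<noteq> 0 \<Longrightarrow> x \<in> K" "K \<subseteq> V"
      by (rule prec_setE) (rule that)
    have "x \<le> \<nu> K" unfolding f(1) by (rule main(1)[OF f(2) K(1,2)])
    also have "\<dots> \<le> \<nu> V" by (rule mono[OF compactin_borel_of[OF K(1)] openin_borel_of[OF V] K(3)])
    finally show "x \<le> \<nu> V" .
  next
    fix b assume b: "\<forall>x\<in>{Finite (\<pi> f) | f. prec_set X f V}. x \<le> b"
    have "x \<le> b" if x: "x \<in> {\<nu> K | K. compactin X K \<and> K \<subseteq> V}" for x
    proof -
      obtain A where A: "x = \<nu> A" "compactin X A" "A \<subseteq> V" using x by auto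
      obtain f where f: "prec_set X f V" "set_prec X A f" by (rule urysohn[OF A(2) V A(3)])
      from f(1) obtain K where K: "compactin X K" "\<And>x. f x \<noteq> 0 \<Longrightarrow> x \<in> K"
        by (rule prec_setE) (rule that)
      have f1: "f y = 1" if "y \<in> A" for y using f(2) that by (simp add: set_prec_def)
      have "A \<subseteq> K" by (rule subsetI, rule K(2)) (simp add: f1)
      with A(2) have "\<nu> A \<le> Finite (\<pi> f)" by (intro main(2)[OF f(1) K]) (simp_all add: f1)
      also have "\<dots> \<le> b" using b f(1) by auto
      finally show ?thesis unfolding A(1) .
    qed
    then show "\<nu> V \<le> b" using inner unfolding isLub_UNIV_iff by simp
  qed
qed

lemma regular_borel_measure_unique:
  assumes reg: "regular_borel_measure X \<nu>" "regular_borel_measure X \<nu>'"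
    and rep: "\<And>f. f \<in> Cc X \<Longrightarrow> represents_at X \<nu> \<pi> f" "\<And>f. f \<in> Cc X \<Longrightarrow> represents_at X \<nu>' \<pi> f"
  shows "\<nu> = \<nu>'"
proof
  fix A
  have opens: "\<nu> V = \<nu>' V" if "openin X V" for V
    using regular_borel_measure_open_lub[OF reg(1) rep(1) that]
      regular_borel_measure_open_lub[OF reg(2) rep(2) that] by (rule isLub_UNIV_unique)
  show "\<nu> A = \<nu>' A"
  proof (cases "A \<in> sets (borel_of X)")
    case True
    have eq: "{\<nu> V | V. openin X V \<and> A \<subseteq> V} = {\<nu>' V | V. openin X V \<and> A \<subseteq> V}"
      unfolding setcompr_eq_image by (rule image_cong) (simp_all add: opens)
    have "outer_regular_at X \<nu> A" "outer_regular_at X \<nu>' A"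
      using reg True by (simp_all add: regular_borel_measure_def)
    then show ?thesis unfolding outer_regular_at_def eq by (rule isGlb_UNIV_unique)
  next
    case False
    \<comment> \<open>Off the \<sigma>-algebra both functions take the default value, because
      measures are extensional.\<close>
    have undef: "\<rho> A = undefined" if "regular_borel_measure X \<rho>" for \<rho> :: "'x set \<Rightarrow> 'e top"
    proof -
      have "positive_vector_measure (borel_of X) \<rho>"
        using that by (simp add: regular_borel_measure_def)
      then have "\<rho> \<in> sets (borel_of X) \<rightarrow>\<^sub>E {a. 0 \<le> a}"
        unfolding positive_vector_measure_def by (rule conjunct1)
      then show ?thesis using False by (rule PiE_arb)
    qed
    show ?thesis using undef[OF reg(1)] undef[OF reg(2)] by simp
  qed
qed

end

theorem theorem6p2:
  fixes X :: "'x topology" and \<pi> :: "('x \<Rightarrow> real) \<Rightarrow> 'e::kb_space"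
  assumes "locally_compact_space X" and "Hausdorff_space X"
    and "positive_operator (C0 X) \<pi>"
  shows "\<exists>\<mu>. (regular_borel_measure X \<mu> \<and> (\<forall>f\<in>Cc X. represents_at X \<mu> \<pi> f)) \<and>
    (\<forall>\<nu>. regular_borel_measure X \<nu> \<and> (\<forall>f\<in>Cc X. represents_at X \<nu> \<pi> f) \<longrightarrow> \<nu> = \<mu>) \<and>
    finite_vector_measure (borel_of X) \<mu> \<and>
    (\<forall>f\<in>C0 X. represents_at X \<mu> \<pi> f) \<and>
    (\<forall>V. openin X V \<and> V \<noteq> {} \<longrightarrow>
       (\<exists>a. \<mu> V = Finite a \<and> isLub UNIV {\<pi> f | f. prec_set X f V} a)) \<and>
    (\<forall>K. compactin X K \<longrightarrow>
       (\<exists>a. \<mu> K = Finite a \<and> isGlb UNIV {\<pi> f | f. set_prec X K f} a))"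
proof -
  interpret riesz X \<pi> using assms by unfold_locales
  have rep: "represents_at X \<mu> \<pi> f" if "f \<in> Cc X" for f
    by (rule represents_C0[OF Cc_imp_C0[OF that]])
  show ?thesis
  proof (intro exI[of _ \<mu>] conjI ballI allI impI)
    show "regular_borel_measure X \<mu>" by (rule regular_borel_measure_\<mu>)
    show "represents_at X \<mu> \<pi> f" if "f \<in> Cc X" for f by (rule rep[OF that])
    show "represents_at X \<mu> \<pi> f" if "f \<in> C0 X" for f by (rule represents_C0[OF that])
    show "\<nu> = \<mu>" if "regular_borel_measure X \<nu> \<and> (\<forall>f\<in>Cc X. represents_at X \<nu> \<pi> f)" for \<nu>
      using that regular_borel_measure_unique[OF _ regular_borel_measure_\<mu> _ rep] by simp
    show "finite_vector_measure (borel_of X) \<mu>"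
      by (simp add: finite_vector_measure_def space_borel_of \<mu>_open_eq)
    show "\<exists>a. \<mu> V = Finite a \<and> isLub UNIV {\<pi> f | f. prec_set X f V} a" if "openin X V \<and> V \<noteq> {}" for V
      using \<mu>_open_eq[OF conjunct1[OF that]] \<mu>_open_lub by simp
    show "\<exists>a. \<mu> K = Finite a \<and> isGlb UNIV {\<pi> f | f. set_prec X K f} a" if "compactin X K" for K
      using \<mu>_eq[OF compactin_borel_of[OF that]] \<mu>_compact_glb[OF that] by simp
  qed
qed

end
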